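(* Every continuous linear operator $T\in\mathcal{L}(X)$ acting on an infinite-dimensional complex Banach space $X$ admits an essentially-invariant halfspace.
   Context: $\mathcal{L}(X)$ denotes the algebra of all continuous linear operators on $X$, and $\mathcal{K}(X)$ the compact ones. A halfspace of $X$ is a closed subspace of $X$ with both infinite dimension and infinite codimension in $X$. A subspace $Y$ of $X$ is essentially-invariant under $T\in\mathcal{L}(X)$ if it is invariant under $T+K$ for some $K\in\mathcal{K}(X)$, i.e. $(T+K)Y\subseteq Y$. An essentially-invariant halfspace is a halfspace which is essentially-invariant under $T$. *)

theory Defs
  imports "HOL-Analysis.Analysis"
begin

text \<open>Complex Banach spaces extend the real ones of the library, so norm, topology and completeness
  are inherited; \<open>scaleC_of_real\<close> makes the two scalar multiplications agree on the reals.\<close>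

class complex_normed_vector = real_normed_vector +
  fixes scaleC :: "complex \<Rightarrow> 'a \<Rightarrow> 'a"  (infixr \<open>*\<^sub>C\<close> 75)
  assumes scaleC_add_right: "a *\<^sub>C (x + y) = a *\<^sub>C x + a *\<^sub>C y"
    and scaleC_add_left: "(a + b) *\<^sub>C x = a *\<^sub>C x + b *\<^sub>C x"
    and scaleC_scaleC: "a *\<^sub>C b *\<^sub>C x = (a * b) *\<^sub>C x"
    and scaleC_of_real: "complex_of_real r *\<^sub>C x = r *\<^sub>R x"
    and norm_scaleC: "norm (a *\<^sub>C x) = cmod a * norm x"

class complex_banach = complex_normed_vector + complete_space

global_interpretation complex_vector:
  vector_space "scaleC :: complex \<Rightarrow> 'a \<Rightarrow> 'a::complex_normed_vector"
proof
  show "1 *\<^sub>C x = x" for x :: 'a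
    using scaleC_of_real[of 1 x] by simp
qed (simp_all add: scaleC_add_right scaleC_add_left scaleC_scaleC)

definition continuous_operator :: "('a::complex_normed_vector \<Rightarrow> 'a) \<Rightarrow> bool" where
  "continuous_operator T \<longleftrightarrow> Vector_Spaces.linear scaleC scaleC T \<and> continuous_on UNIV T"

definition compact_operator :: "('a::complex_normed_vector \<Rightarrow> 'a) \<Rightarrow> bool" where
  "compact_operator K \<longleftrightarrow>
     continuous_operator K \<and> (\<forall>S. bounded S \<longrightarrow> compact (closure (K ` S)))"

definition finite_dimensional :: "'a::complex_normed_vector set \<Rightarrow> bool" where
  "finite_dimensional Y \<longleftrightarrow> (\<exists>B. finite B \<and> complex_vector.span B = Y)"

text \<open>Finite codimension says that the cosets of finitely many vectors span the quotient of the
  whole space by \<open>Y\<close>, written without forming the quotient.\<close>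

definition finite_codimensional :: "'a::complex_normed_vector set \<Rightarrow> bool" where
  "finite_codimensional Y \<longleftrightarrow>
     (\<exists>B. finite B \<and> (\<forall>x. \<exists>b \<in> complex_vector.span B. x - b \<in> Y))"

definition halfspace :: "'a::complex_normed_vector set \<Rightarrow> bool" where
  "halfspace Y \<longleftrightarrow> complex_vector.subspace Y \<and> closed Y
     \<and> \<not> finite_dimensional Y \<and> \<not> finite_codimensional Y"

definition essentially_invariant ::
    "('a::complex_normed_vector \<Rightarrow> 'a) \<Rightarrow> 'a set \<Rightarrow> bool" where
  "essentially_invariant T Y \<longleftrightarrow>
     (\<exists>K. compact_operator K \<and> (\<lambda>x. T x + K x) ` Y \<subseteq> Y)"

end

theory Submission
  imports Defs
begin

text \<open>
The halfspace is produced together with a perturbation that turns the operator into a scalar on it.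
Suppose that for some scalar \<open>z\<close> the operator \<open>L = T - z\<close> is not bounded below modulo compact
operators: for every compact \<open>P\<close> the range of \<open>I - P\<close> contains unit vectors on which \<open>L\<close> is as small
as desired. Taking for \<open>P\<close> the projection onto the span of the vectors already chosen, one
builds a sequence \<open>y n\<close> with biorthogonal continuous functionals \<open>\<psi> n\<close> such that
\<open>norm (\<psi> n) * norm (L (y n)) \<le> (1 / 2) ^ n\<close> (\<open>ex_biorthogonal_sequence\<close>). The series
\<open>K x = - (\<Sum>n. \<psi> n x *\<^sub>C L (y n))\<close> is then a compact operator with \<open>T + K = z\<close> on every \<open>y n\<close>,
so every closed span of some of the \<open>y n\<close> is invariant under \<open>T + K\<close>. The span of those with even
index has infinite dimension, and infinite codimension because the \<open>\<psi> n\<close> with odd \<open>n\<close> vanish on it.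

The existence of \<open>z\<close> is the statement that the class of \<open>T\<close> modulo compact operators has an
approximate eigenvalue. Only polynomials in \<open>T\<close> are needed for it: \<open>q p\<close>, the Hausdorff measure of
noncompactness of the image of the unit ball under \<open>p(T)\<close>, is a seminorm on complex polynomials,
for which multiplication by \<open>X\<close> is bounded, and \<open>q 1 > 0\<close> as the space is infinite-dimensional.
If multiplication by \<open>X - z\<close> were bounded below for every \<open>z\<close>, compactness of a disc would give one
bound \<open>c > 0\<close> for all \<open>z\<close>. Averaging approximate resolvents over a circle in the manner of Rickart,
an elementary substitute for Liouville's theorem, then shows that a growth rate \<open>r\<close> of the powers of \<open>X\<close> can always be lowered by a fixed amount
(\<open>poly_seminorm.contraction_step\<close>). Since \<open>X ^ N\<close> grows at least like \<open>c ^ N\<close>, this is impossible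
(\<open>poly_seminorm.approximate_eigenvalue\<close>).

The functionals come from the Hahn-Banach theorem in the form \<open>ex_norming_functional\<close>: a minimal
sublinear functional below the norm is linear.
\<close>

section \<open>A seminorm on polynomials has an approximate eigenvalue of multiplication by X\<close>

lemma unity_root_power:
  assumes "0 < N"
  shows "(cis (2 * pi / N) ^ k) ^ N = 1"
proof -
  have "(cis (2 * pi / N) ^ k) ^ N = (cis (2 * pi / N) ^ N) ^ k"
    by (metis power_mult mult.commute)
  also have "cis (2 * pi / N) ^ N = cis (2 * pi)"
    unfolding Complex.DeMoivre using assms by simp
  finally show ?thesis by simp
qed

lemma sum_powers_of_unity_root:
  assumes "0 < j" "j \<le> N"
  shows "(\<Sum>k<N. (cis (2 * pi / N) ^ k) ^ j) = (if j = N then of_nat N else 0)"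
proof -
  let ?w = "cis (2 * pi / N) ^ j"
  have "?w = cis (2 * pi * (j / N))"
    by (simp add: Complex.DeMoivre mult.commute)
  moreover have "cis (2 * pi * (j / N)) \<noteq> 1" if "j < N"
  proof -
    have "cos (2 * pi * (j / N)) \<noteq> 1"
    proof
      assume "cos (2 * pi * (j / N)) = 1"
      then obtain i :: int where "2 * pi * (j / N) = real_of_int i * 2 * pi"
        unfolding cos_one_2pi_int by auto
      then have "(2 * pi) * (j / N) = (2 * pi) * real_of_int i" by simp
      then have "j / N = real_of_int i" unfolding mult_cancel_left by simp
      moreover have "0 < j / N" "j / N < 1" using that assms by auto
      ultimately show False by simp
    qed
    then show ?thesis by (simp add: complex_eq_iff)
  qed
  ultimately have neq: "?w \<noteq> 1" if "j < N" using that by metis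
  have eq: "(cis (2 * pi / N) ^ k) ^ j = ?w ^ k" for k
    by (metis power_mult mult.commute)
  have N: "?w ^ N = 1"
    using assms by (intro unity_root_power) simp
  show ?thesis
  proof (cases "j = N")
    case True
    have "(cis (2 * pi / N) ^ k) ^ j = 1" for k
      unfolding True using assms by (intro unity_root_power) simp
    then show ?thesis using True by simp
  next
    case False
    then have "?w \<noteq> 1" using neq assms by simp
    then have "(\<Sum>k<N. ?w ^ k) = 0"
      by (simp add: geometric_sum N)
    then show ?thesis using False by (simp add: eq)
  qed
qed

lemma smult_sum_right: "smult c (sum f A) = (\<Sum>i\<in>A. smult c (f i))"
  by (induction A rule: infinite_finite_induct) (simp_all add: smult_add_right)

text \<open>The quotient of \<open>X ^ N - z ^ N\<close> by \<open>X - z\<close>. When \<open>z ^ N = r ^ N\<close> it represents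
  \<open>(X ^ N - r ^ N) / (X - z)\<close> as a polynomial.\<close>
definition cofactor :: "nat \<Rightarrow> complex \<Rightarrow> complex poly" where
  "cofactor N z = (\<Sum>i<N. [:z:] ^ (N - Suc i) * [:0, 1:] ^ i)"

lemma linear_factor_mult: "[:- z, 1:] * p = [:0, 1:] * p - smult z p"
  for z :: "'a::comm_ring_1"
  by simp

lemma linear_factor_times_cofactor: "[:- z, 1:] * cofactor N z = [:0, 1:] ^ N - [:z ^ N:]"
proof -
  have "[:- z, 1:] = [:0, 1:] - [:z:]" by simp
  then have "[:- z, 1:] * cofactor N z = [:0, 1:] ^ N - [:z:] ^ N"
    unfolding cofactor_def by (simp only: power_diff_sumr2)
  also have "[:z:] ^ N = [:z ^ N:]" by (rule poly_const_pow)
  finally show ?thesis .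
qed

text \<open>Partial fractions of \<open>1 / (X ^ N - r ^ N)\<close>, multiplied by \<open>X ^ N - r ^ N\<close>: summation over the \<open>N\<close>-th
  roots of \<open>r ^ N\<close> kills every power of \<open>X\<close> except the constant one.\<close>
lemma sum_cofactors_over_circle:
  fixes r :: complex
  assumes "0 < N"
  defines "w \<equiv> \<lambda>k. cis (2 * pi / N) ^ k"
  shows "(\<Sum>k<N. smult (r * w k) (cofactor N (r * w k))) = [:of_nat N * r ^ N:]"
proof -
  have "(\<Sum>k<N. smult (r * w k) (cofactor N (r * w k)))
      = (\<Sum>k<N. \<Sum>i<N. smult ((r * w k) ^ (N - i)) ([:0, 1:] ^ i))"
  proof (intro sum.cong refl)
    fix k
    have "smult (r * w k) ([:r * w k:] ^ (N - Suc i) * [:0, 1:] ^ i)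
        = smult ((r * w k) ^ (N - i)) ([:0, 1:] ^ i)" if "i < N" for i
    proof -
      have "N - i = Suc (N - Suc i)" using that by simp
      then show ?thesis by (simp add: poly_const_pow)
    qed
    then have "(\<Sum>i<N. smult (r * w k) ([:r * w k:] ^ (N - Suc i) * [:0, 1:] ^ i))
        = (\<Sum>i<N. smult ((r * w k) ^ (N - i)) ([:0, 1:] ^ i))"
      by (intro sum.cong) auto
    moreover have "smult (r * w k) (cofactor N (r * w k))
        = (\<Sum>i<N. smult (r * w k) ([:r * w k:] ^ (N - Suc i) * [:0, 1:] ^ i))"
      unfolding cofactor_def by (rule smult_sum_right)
    ultimately show "smult (r * w k) (cofactor N (r * w k))
        = (\<Sum>i<N. smult ((r * w k) ^ (N - i)) ([:0, 1:] ^ i))"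
      by simp
  qed
  also have "\<dots> = (\<Sum>i<N. smult (\<Sum>k<N. (r * w k) ^ (N - i)) ([:0, 1:] ^ i))"
    by (subst sum.swap) (simp add: smult_sum)
  also have "\<dots> = (\<Sum>i<N. if i = 0 then [:of_nat N * r ^ N:] else 0)"
  proof (intro sum.cong refl)
    fix i assume "i \<in> {..<N}"
    then have "(\<Sum>k<N. w k ^ (N - i)) = (if i = 0 then of_nat N else 0)"
      using sum_powers_of_unity_root[of "N - i" N] by (auto simp: w_def)
    then have "(\<Sum>k<N. (r * w k) ^ (N - i)) = (if i = 0 then of_nat N * r ^ N else 0)"
      by (auto simp: power_mult_distrib simp flip: sum_distrib_left)
    then show "smult (\<Sum>k<N. (r * w k) ^ (N - i)) ([:0, 1:] ^ i)
        = (if i = 0 then [:of_nat N * r ^ N:] else 0)"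
      by auto
  qed
  also have "\<dots> = [:of_nat N * r ^ N:]" using assms by simp
  finally show ?thesis .
qed

locale poly_seminorm =
  fixes q :: "complex poly \<Rightarrow> real"
  assumes add: "q (p + p') \<le> q p + q p'"
    and smult: "q (smult k p) = cmod k * q p"
begin

lemma zero: "q 0 = 0"
  using smult[of 0 0] by simp

lemma minus: "q (- p) = q p"
  using smult[of "-1" p] by simp

lemma nonneg: "0 \<le> q p"
  using add[of p "- p"] by (simp add: zero minus)

lemma diff: "q (p - p') \<le> q p + q p'"
  using add[of p "- p'"] by (simp add: minus)

lemma sum_le: "q (\<Sum>i\<in>A. f i) \<le> (\<Sum>i\<in>A. q (f i))"
proof (induction A rule: infinite_finite_induct)
  case (insert x F)
  then show ?case using add[of "f x" "sum f F"] by simp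
qed (simp_all add: zero)

text \<open>Rickart's step. Formally, the average of \<open>z / (z - X)\<close> over the \<open>N\<close>-th roots of \<open>r ^ N\<close> is
  \<open>1 / (1 - (X / r) ^ N)\<close>, which is close to 1 exactly when \<open>(X / r) ^ N\<close> is small. The uniform lower bound
  makes the resolvent Lipschitz in \<open>z\<close> with a constant that does not depend on \<open>N\<close>, so the averages
  for the nearby radii \<open>r\<close> and \<open>s\<close> differ little, and smallness of \<open>(X / r) ^ N\<close> is
  passed on, in the weaker form of boundedness by 1, to \<open>(X / s) ^ N\<close>.\<close>
lemma contraction_step:
  assumes c: "0 < c" "\<And>z p. c * q p \<le> q ([:- z, 1:] * p)"
    and e: "\<And>p. q ([:0, 1:] ^ N * p) \<le> e * r ^ N * q p"
    and rs: "0 < s" "s \<le> r" and N: "0 < N"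
    and small: "(r - s) / c + r * ((r - s) / c + e) / c \<le> 1 / 2"
  shows "q ([:0, 1:] ^ N * y) \<le> s ^ N * q y"
proof -
  define X :: "complex poly" where "X = [:0, 1:]"
  define w where "w = (\<lambda>k. cis (2 * pi / N) ^ k)"
  \<comment> \<open>The average at \<open>s\<close> is applied to a multiple of \<open>X ^ N - s ^ N\<close>, where the resolvents \<open>u k\<close> are exact;
    at \<open>r\<close> the polynomial \<open>y'\<close> inverts \<open>X ^ N - r ^ N\<close> up to the small error \<open>d\<close> below.\<close>
  define x where "x = X ^ N * y - smult (of_real s ^ N) y"
  define y' where "y' = - smult (1 / of_real r ^ N) x"
  define u where "u = (\<lambda>k. cofactor N (s * w k) * y)"
  define v where "v = (\<lambda>k. cofactor N (r * w k) * y')"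
  have r: "0 < r" using rs by simp
  have w1: "cmod (w k) = 1" for k by (simp add: w_def norm_power)
  have wN: "w k ^ N = 1" for k
    unfolding w_def using N by (rule unity_root_power)
  have u: "[:- (s * w k), 1:] * u k = x" for k
    unfolding u_def mult.assoc[symmetric] linear_factor_times_cofactor
    by (simp add: x_def X_def power_mult_distrib wN left_diff_distrib)
  define d where "d = smult (1 / of_real r ^ N) (X ^ N * x)"
  have v: "[:- (r * w k), 1:] * v k = x - d" for k
    unfolding v_def mult.assoc[symmetric] linear_factor_times_cofactor using r
    by (simp add: y'_def d_def X_def power_mult_distrib wN left_diff_distrib smult_diff_right)
  have qd: "q d \<le> e * q x"
  proof -
    have "q d = q (X ^ N * x) / r ^ N"
      using r by (simp add: d_def smult norm_divide norm_power)
    also have "\<dots> \<le> e * r ^ N * q x / r ^ N"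
      using e[of x] r by (intro divide_right_mono) (simp_all add: X_def)
    finally show ?thesis using r by simp
  qed
  have qu: "q (u k) \<le> q x / c" for k
    using c(2)[of "u k" "s * w k"] c(1) unfolding u by (simp add: field_simps)
  have uv: "q (u k - v k) \<le> ((r - s) / c + e) * q x / c" for k
  proof -
    have "[:- (r * w k), 1:] * (u k - v k)
        = [:- (s * w k), 1:] * u k - smult ((r - s) * w k) (u k) - [:- (r * w k), 1:] * v k"
      unfolding linear_factor_mult
      by (simp add: algebra_simps smult_diff_left smult_diff_right del: mult_pCons_left)
    also have "\<dots> = d - smult ((r - s) * w k) (u k)"
      unfolding u v by simp
    finally have eq: "[:- (r * w k), 1:] * (u k - v k) = d - smult ((r - s) * w k) (u k)" .
    have "q (smult ((r - s) * w k) (u k)) = (r - s) * q (u k)"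
      using rs by (simp add: smult norm_mult w1 flip: of_real_diff)
    also have "\<dots> \<le> (r - s) * (q x / c)"
      using rs by (intro mult_left_mono qu) simp
    finally have "q (d - smult ((r - s) * w k) (u k)) \<le> e * q x + (r - s) * (q x / c)"
      using diff[of d "smult ((r - s) * w k) (u k)"] qd by linarith
    then have "c * q (u k - v k) \<le> e * q x + (r - s) * (q x / c)"
      using c(2)[of "u k - v k" "r * w k"] unfolding eq by linarith
    then show ?thesis using c(1) by (simp add: field_simps)
  qed
  have summand: "q (smult (s * w k) (u k) - smult (r * w k) (v k)) \<le> q x / 2" for k
  proof -
    have "smult (s * w k) (u k) - smult (r * w k) (v k)
        = smult (r * w k) (u k - v k) - smult ((r - s) * w k) (u k)"
      by (simp add: algebra_simps smult_diff_left smult_diff_right)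
    then have "q (smult (s * w k) (u k) - smult (r * w k) (v k))
        \<le> q (smult (r * w k) (u k - v k)) + q (smult ((r - s) * w k) (u k))"
      using diff by simp
    also have "\<dots> = r * q (u k - v k) + (r - s) * q (u k)"
      using rs r by (simp add: smult norm_mult w1 flip: of_real_diff)
    also have "\<dots> \<le> r * (((r - s) / c + e) * q x / c) + (r - s) * (q x / c)"
      using rs r by (intro add_mono mult_left_mono uv qu) auto
    also have "\<dots> = ((r - s) / c + r * ((r - s) / c + e) / c) * q x"
      by (simp add: algebra_simps)
    also have "\<dots> \<le> 1 / 2 * q x"
      using small by (intro mult_right_mono nonneg)
    finally show ?thesis by simp
  qed
  have "(\<Sum>k<N. smult (s * w k) (u k) - smult (r * w k) (v k))
      = (\<Sum>k<N. smult (s * w k) (cofactor N (s * w k))) * y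
        - (\<Sum>k<N. smult (r * w k) (cofactor N (r * w k))) * y'"
    by (simp add: u_def v_def sum_subtractf sum_distrib_right)
  also have "\<dots> = [:of_nat N * of_real s ^ N:] * y - [:of_nat N * of_real r ^ N:] * y'"
    unfolding w_def sum_cofactors_over_circle[OF N] ..
  also have "\<dots> = smult (of_nat N) (X ^ N * y)"
    using r by (simp add: y'_def x_def smult_diff_right smult_add_right)
  finally have "of_nat N * q (X ^ N * y) = q (\<Sum>k<N. smult (s * w k) (u k) - smult (r * w k) (v k))"
    by (simp add: smult)
  also have "\<dots> \<le> (\<Sum>k<N. q (smult (s * w k) (u k) - smult (r * w k) (v k)))"
    by (rule sum_le)
  also have "\<dots> \<le> (\<Sum>k<N. q x / 2)"
    by (intro sum_mono summand)
  finally have "q (X ^ N * y) \<le> q x / 2" using N by simp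
  moreover have "q x \<le> q (X ^ N * y) + s ^ N * q y"
    using diff[of "X ^ N * y" "smult (of_real s ^ N) y"] rs
    by (simp add: x_def smult norm_power)
  ultimately show ?thesis by (simp add: X_def)
qed

text \<open>The radii \<open>r\<close> for which eventually \<open>X ^ N\<close> is small compared to \<open>r ^ N\<close> form a set that is bounded
  below by \<open>c\<close> and yet closed under subtraction of the fixed amount \<open>d / 2\<close>.\<close>
lemma no_uniform_lower_bound:
  assumes C: "0 \<le> C" "\<And>p. q ([:0, 1:] * p) \<le> C * q p"
    and c: "0 < c" "\<And>z p. c * q p \<le> q ([:- z, 1:] * p)"
  shows "q p = 0"
proof (rule ccontr)
  assume "q p \<noteq> 0"
  then have qp: "0 < q p" using nonneg[of p] by simp
  define R where "R = C + 1 + c"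
  \<comment> \<open>With these constants each of the three error terms in \<open>contraction_step\<close> is at most 1/6.\<close>
  define e where "e = c / (6 * R)"
  define d where "d = c\<^sup>2 / (6 * R)"
  have R: "0 < R" "c \<le> R" "C < R" using C c by (auto simp: R_def)
  have e: "0 < e" "e < 1" using R c by (auto simp: e_def)
  have d: "0 < d" "d \<le> c / 6"
    using R c by (auto simp: d_def field_simps power2_eq_square)
  define S where "S = {r. 0 < r \<and> r \<le> R \<and>
    (\<forall>\<^sub>F N in sequentially. \<forall>p. q ([:0, 1:] ^ N * p) \<le> e * r ^ N * q p)}"
  have small_ratio: "\<forall>\<^sub>F N in sequentially. s ^ N \<le> e * t ^ N" if "0 \<le> s" "s < t" for s t :: real
  proof -
    have "(\<lambda>N. (s / t) ^ N) \<longlonglongrightarrow> 0" using that by (intro LIMSEQ_realpow_zero) auto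
    then have "\<forall>\<^sub>F N in sequentially. (s / t) ^ N < e" using e order_tendstoD(2) by blast
    then show ?thesis
      by (rule eventually_mono) (use that in \<open>simp add: power_divide field_simps\<close>)
  qed
  have upper: "q ([:0, 1:] ^ N * p) \<le> C ^ N * q p" for N p
  proof (induction N)
    case (Suc N)
    have "q ([:0, 1:] * ([:0, 1:] ^ N * p)) \<le> C * (C ^ N * q p)"
      using C(2)[of "[:0, 1:] ^ N * p"] mult_left_mono[OF Suc C(1)] by linarith
    then show ?case by (simp add: mult.assoc)
  qed simp
  have lower: "c ^ N * q p \<le> q ([:0, 1:] ^ N * p)" for N p
  proof (induction N)
    case (Suc N)
    have "c * (c ^ N * q p) \<le> q ([:0, 1:] * ([:0, 1:] ^ N * p))"
      using c(2)[of "[:0, 1:] ^ N * p" 0] mult_left_mono[OF Suc less_imp_le[OF c(1)]]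
      by (simp del: mult_pCons_left)
    then show ?case by (simp add: mult.assoc)
  qed simp
  have RS: "R \<in> S"
    using small_ratio[OF C(1) R(3)] R(1) unfolding S_def
    by (auto elim!: eventually_mono intro: order.trans[OF upper] mult_right_mono nonneg)
  have S_ge: "c \<le> r" if "r \<in> S" for r
  proof (rule ccontr)
    assume "\<not> c \<le> r"
    obtain N where "q ([:0, 1:] ^ N * p) \<le> e * r ^ N * q p"
      using \<open>r \<in> S\<close> eventually_happens'[OF sequentially_bot] unfolding S_def by blast
    then have "c ^ N * q p \<le> e * r ^ N * q p" using lower[of N p] by linarith
    then have "c ^ N \<le> e * r ^ N" using qp by simp
    moreover have "r ^ N \<le> c ^ N"
      using \<open>\<not> c \<le> r\<close> that by (intro power_mono) (auto simp: S_def)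
    moreover have "e * r ^ N < r ^ N" using e that by (auto simp: S_def)
    ultimately show False by linarith
  qed
  have S_step: "r - d / 2 \<in> S" if "r \<in> S" for r
  proof -
    have r: "c \<le> r" "r \<le> R" using that S_ge by (auto simp: S_def)
    have small: "(r - (r - d)) / c + r * ((r - (r - d)) / c + e) / c \<le> 1 / 2"
    proof -
      have "r * (d / c + e) / c \<le> R * (d / c + e) / c"
        using r c d e by (intro divide_right_mono mult_right_mono) auto
      also have "\<dots> = 1 / 3" using R c by (simp add: d_def e_def field_simps power2_eq_square)
      finally have "r * (d / c + e) / c \<le> 1 / 3" .
      moreover have "d / c \<le> 1 / 6" using d c by (simp add: field_simps)
      ultimately have "d / c + r * (d / c + e) / c \<le> 1 / 2" by linarith
      moreover have "r - (r - d) = d" by simp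
      ultimately show ?thesis by simp
    qed
    have pos: "0 < r - d" using r d c by linarith
    have "\<forall>\<^sub>F N in sequentially. \<forall>p. q ([:0, 1:] ^ N * p) \<le> e * r ^ N * q p"
      using that by (simp add: S_def)
    then have "\<forall>\<^sub>F N in sequentially. \<forall>p. q ([:0, 1:] ^ N * p) \<le> (r - d) ^ N * q p"
      using eventually_gt_at_top[of 0]
    proof eventually_elim
      case (elim N)
      show ?case
      proof
        fix y show "q ([:0, 1:] ^ N * y) \<le> (r - d) ^ N * q y"
          using contraction_step[OF c, of N e r "r - d" y] elim small pos d by auto
      qed
    qed
    moreover have "\<forall>\<^sub>F N in sequentially. (r - d) ^ N \<le> e * (r - d / 2) ^ N"
      using pos d by (intro small_ratio) auto
    ultimately have "\<forall>\<^sub>F N in sequentially. \<forall>p. q ([:0, 1:] ^ N * p) \<le> e * (r - d / 2) ^ N * q p"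
    proof eventually_elim
      case (elim N)
      then show ?case by (meson mult_right_mono nonneg order.trans)
    qed
    then show ?thesis using pos r d by (auto simp: S_def)
  qed
  have bdd: "bdd_below S" using S_ge by (auto simp: bdd_below_def)
  obtain r where "r \<in> S" "r < Inf S + d / 2"
    using cInf_lessD[of S "Inf S + d / 2"] RS d by auto
  then show False
    using cInf_lower[OF S_step bdd, of r] by linarith
qed

theorem approximate_eigenvalue:
  assumes C: "0 \<le> C" "\<And>p. q ([:0, 1:] * p) \<le> C * q p" and nz: "q p0 \<noteq> 0"
  obtains z where "\<And>e. 0 < e \<Longrightarrow> \<exists>p. q ([:- z, 1:] * p) < e * q p"
proof -
  have "\<exists>z. \<forall>e>0. \<exists>p. q ([:- z, 1:] * p) < e * q p"
  proof (rule ccontr)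
    assume "\<nexists>z. \<forall>e>0. \<exists>p. q ([:- z, 1:] * p) < e * q p"
    then have "\<forall>z. \<exists>e>0. \<forall>p. e * q p \<le> q ([:- z, 1:] * p)"
      by (meson linorder_not_less)
    then obtain e where e: "\<And>z. 0 < e z" "\<And>z p. e z * q p \<le> q ([:- z, 1:] * p)"
      by metis
    \<comment> \<open>The best lower bound is Lipschitz in \<open>z\<close>, hence uniform on a disc; outside of the disc
      multiplication by \<open>X\<close> is dominated by multiplication by \<open>z\<close>.\<close>
    have shift: "q ([:- z, 1:] * p) \<le> q ([:- z', 1:] * p) + cmod (z - z') * q p" for z z' p
    proof -
      have "[:- z, 1:] * p = [:- z', 1:] * p - smult (z - z') p"
        by (simp add: algebra_simps smult_diff_left)
      then show ?thesis using diff smult by metis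
    qed
    obtain D where D: "finite D" "cball 0 (C + 1) \<subseteq> (\<Union>z\<in>D. ball z (e z / 2))"
    proof (rule compactE_image[OF compact_cball[of "0 :: complex" "C + 1"]])
      show "cball 0 (C + 1) \<subseteq> (\<Union>z\<in>UNIV. ball z (e z / 2))"
        using e(1) by (meson UN_I UNIV_I centre_in_ball half_gt_zero subsetI)
    qed auto
    define c where "c = Min (insert 1 ((\<lambda>z. e z / 2) ` D))"
    have c: "0 < c" "c \<le> 1"
      using D e(1) by (auto simp: c_def Min_gr_iff)
    have c_le: "c \<le> e z / 2" if "z \<in> D" for z
      unfolding c_def using D that by (intro Min_le) auto
    have "c * q p \<le> q ([:- z, 1:] * p)" for z p
    proof (cases "cmod z \<le> C + 1")
      case True
      then have "z \<in> cball 0 (C + 1)" by simp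
      then obtain z' where z': "z' \<in> D" "dist z' z < e z' / 2" using D(2) by auto
      have "e z' * q p \<le> q ([:- z, 1:] * p) + cmod (z' - z) * q p"
        using e(2)[of z' p] shift[of z' p z] by linarith
      also have "cmod (z' - z) * q p \<le> e z' / 2 * q p"
        using z' by (intro mult_right_mono nonneg) (simp add: dist_norm)
      finally have "e z' / 2 * q p \<le> q ([:- z, 1:] * p)" by simp
      moreover have "c * q p \<le> e z' / 2 * q p"
        using c_le z' by (intro mult_right_mono nonneg) auto
      ultimately show ?thesis by linarith
    next
      case False
      have "[:0, 1:] * p - [:- z, 1:] * p = smult z p"
        by simp
      then have "cmod z * q p \<le> C * q p + q ([:- z, 1:] * p)"
        using diff[of "[:0, 1:] * p" "[:- z, 1:] * p"] C(2)[of p] smult[of z p] by auto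
      moreover have "(C + 1) * q p \<le> cmod z * q p"
        using False by (intro mult_right_mono nonneg) auto
      moreover have "c * q p \<le> 1 * q p" using c by (intro mult_right_mono nonneg)
      ultimately show ?thesis by (simp add: algebra_simps)
    qed
    then have "q p0 = 0" by (rule no_uniform_lower_bound[OF C c(1)])
    then show False using nz by simp
  qed
  then obtain z where "\<forall>e>0. \<exists>p. q ([:- z, 1:] * p) < e * q p" ..
  then show ?thesis by (intro that[of z]) simp
qed

end

section \<open>Norming functionals\<close>

definition sublinear :: "('a::real_vector \<Rightarrow> real) \<Rightarrow> bool" where
  "sublinear p \<longleftrightarrow> (\<forall>x y. p (x + y) \<le> p x + p y) \<and> (\<forall>t x. 0 \<le> t \<longrightarrow> p (t *\<^sub>R x) = t * p x)"

lemma sublinearI: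
  assumes "\<And>x y. p (x + y) \<le> p x + p y" and "\<And>t x. 0 < t \<Longrightarrow> p (t *\<^sub>R x) \<le> t * p x"
    and "p 0 = 0"
  shows "sublinear p"
proof -
  have "p (t *\<^sub>R x) = t * p x" if "0 \<le> t" for t x
  proof (cases "t = 0")
    case False
    then have t: "0 < t" using that by simp
    have "p ((1 / t) *\<^sub>R (t *\<^sub>R x)) \<le> 1 / t * p (t *\<^sub>R x)"
      using t by (intro assms(2)) simp
    then have "t * p x \<le> p (t *\<^sub>R x)" using t by (simp add: field_simps)
    then show ?thesis using assms(2)[OF t, of x] by simp
  qed (simp add: assms(3))
  then show ?thesis using assms(1) by (auto simp: sublinear_def)
qed

lemma sublinear_add: "sublinear p \<Longrightarrow> p (x + y) \<le> p x + p y"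
  by (simp add: sublinear_def)

lemma sublinear_scale: "sublinear p \<Longrightarrow> 0 \<le> t \<Longrightarrow> p (t *\<^sub>R x) = t * p x"
  by (simp add: sublinear_def)

lemma sublinear_zero: "sublinear p \<Longrightarrow> p 0 = 0"
  using sublinear_scale[of p 0 0] by simp

lemma sublinear_minus: "sublinear p \<Longrightarrow> - p (- x) \<le> p x"
  using sublinear_add[of p x "- x"] by (simp add: sublinear_zero)

text \<open>For sublinear \<open>p\<close>, the largest sublinear functional below \<open>p\<close> whose value at \<open>- a\<close> is at most \<open>- p a\<close>.\<close>
definition tilt :: "('a::real_vector \<Rightarrow> real) \<Rightarrow> 'a \<Rightarrow> 'a \<Rightarrow> real" where
  "tilt p a x = (INF t\<in>{0..}. p (x + t *\<^sub>R a) - t * p a)"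

lemma tilt_lower:
  assumes "sublinear p" "0 \<le> t"
  shows "- p (- x) \<le> p (x + t *\<^sub>R a) - t * p a"
  using sublinear_add[OF assms(1), of "x + t *\<^sub>R a" "- x"] sublinear_scale[OF assms, of a] by simp

lemma tilt_le:
  assumes "sublinear p" "0 \<le> t"
  shows "tilt p a x \<le> p (x + t *\<^sub>R a) - t * p a"
  unfolding tilt_def using tilt_lower[OF assms(1)] assms(2)
  by (intro cINF_lower) (auto simp: bdd_below_def)

lemma tilt_greatest:
  assumes "\<And>t. 0 \<le> t \<Longrightarrow> m \<le> p (x + t *\<^sub>R a) - t * p a"
  shows "m \<le> tilt p a x"
  unfolding tilt_def using assms by (intro cINF_greatest) auto

lemma tilt_le_self: "sublinear p \<Longrightarrow> tilt p a x \<le> p x"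
  using tilt_le[of p 0 a x] by simp

lemma tilt_minus: "sublinear p \<Longrightarrow> tilt p a (- a) \<le> - p a"
  using tilt_le[of p 1 a "- a"] by (simp add: sublinear_zero)

lemma sublinear_tilt:
  assumes p: "sublinear p"
  shows "sublinear (tilt p a)"
proof (rule sublinearI)
  fix x y
  have "tilt p a (x + y) - (p (y + t *\<^sub>R a) - t * p a) \<le> tilt p a x" if t: "0 \<le> t" for t
  proof (rule tilt_greatest)
    fix s :: real assume s: "0 \<le> s"
    have "tilt p a (x + y) \<le> p (x + y + (s + t) *\<^sub>R a) - (s + t) * p a"
      using p s t by (intro tilt_le) auto
    also have "p (x + y + (s + t) *\<^sub>R a) \<le> p (x + s *\<^sub>R a) + p (y + t *\<^sub>R a)"
      using sublinear_add[OF p, of "x + s *\<^sub>R a" "y + t *\<^sub>R a"] by (simp add: algebra_simps)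
    finally show "tilt p a (x + y) - (p (y + t *\<^sub>R a) - t * p a) \<le> p (x + s *\<^sub>R a) - s * p a"
      by (simp add: algebra_simps)
  qed
  then have "tilt p a (x + y) - tilt p a x \<le> tilt p a y"
    by (intro tilt_greatest) (simp add: algebra_simps)
  then show "tilt p a (x + y) \<le> tilt p a x + tilt p a y" by simp
next
  fix t :: real and x assume t: "0 < t"
  have "tilt p a (t *\<^sub>R x) / t \<le> tilt p a x"
  proof (rule tilt_greatest)
    fix s :: real assume s: "0 \<le> s"
    have "tilt p a (t *\<^sub>R x) \<le> p (t *\<^sub>R x + (t * s) *\<^sub>R a) - (t * s) * p a"
      using p s t by (intro tilt_le) auto
    also have "p (t *\<^sub>R x + (t * s) *\<^sub>R a) = t * p (x + s *\<^sub>R a)"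
      using sublinear_scale[OF p, of t "x + s *\<^sub>R a"] t by (simp add: algebra_simps)
    finally show "tilt p a (t *\<^sub>R x) / t \<le> p (x + s *\<^sub>R a) - s * p a"
      using t by (simp add: field_simps)
  qed
  then show "tilt p a (t *\<^sub>R x) \<le> t * tilt p a x" using t by (simp add: field_simps)
next
  have "0 \<le> tilt p a 0"
    by (intro tilt_greatest) (simp add: sublinear_scale[OF p])
  then show "tilt p a 0 = 0" using tilt_le_self[OF p, of a 0] sublinear_zero[OF p] by simp
qed

text \<open>Zorn's lemma: the pointwise infimum of a chain is again sublinear, and it is finite because every
  sublinear functional below \<open>p0\<close> is at least \<open>- p0 (- x)\<close> at \<open>x\<close>.\<close>
lemma ex_minimal_sublinear:
  assumes p0: "sublinear p0"
  obtains p where "sublinear p" "p \<le> p0" "\<And>p'. sublinear p' \<Longrightarrow> p' \<le> p \<Longrightarrow> p' = p"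
proof -
  define A where "A = {p. sublinear p \<and> p \<le> p0}"
  have "\<exists>m\<in>A. \<forall>a\<in>A. a \<le> m \<longrightarrow> a = m"
  proof (rule predicate_Zorn)
    show "partial_order_on A (relation_of (\<lambda>x y. y \<le> x) A)"
      by (rule partial_order_on_relation_ofI) auto
  next
    fix C assume C: "C \<in> Chains (relation_of (\<lambda>x y. y \<le> x) A)"
    then have CA: "\<And>p. p \<in> C \<Longrightarrow> p \<in> A"
      and chain: "\<And>p p'. p \<in> C \<Longrightarrow> p' \<in> C \<Longrightarrow> p \<le> p' \<or> p' \<le> p"
      by (auto simp: Chains_def relation_of_def)
    show "\<exists>u\<in>A. \<forall>a\<in>C. u \<le> a"
    proof (cases "C = {}")
      case True
      then show ?thesis using p0 by (auto simp: A_def)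
    next
      case False
      define u where "u = (\<lambda>x. INF p\<in>C. p x)"
      have sub: "sublinear p" "p \<le> p0" if "p \<in> C" for p using CA[OF that] by (auto simp: A_def)
      have "- p0 (- x) \<le> p x" if "p \<in> C" for p x
        using sublinear_minus[OF sub(1)[OF that], of x] sub(2)[OF that]
        by (smt (verit) le_funE)
      then have bdd: "bdd_below ((\<lambda>p. p x) ` C)" for x by (auto simp: bdd_below_def)
      have u_le: "u x \<le> p x" if "p \<in> C" for p x
        unfolding u_def using bdd that by (intro cINF_lower)
      have u_ge: "m \<le> u x" if "\<And>p. p \<in> C \<Longrightarrow> m \<le> p x" for m x
        unfolding u_def using False that by (intro cINF_greatest)
      have "sublinear u"
      proof (rule sublinearI)
        fix x y
        have "u (x + y) - p' y \<le> u x" if p': "p' \<in> C" for p'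
        proof (rule u_ge)
          fix p assume p: "p \<in> C"
          obtain r where r: "r \<in> C" "r \<le> p" "r \<le> p'" using chain[OF p p'] p p' by blast
          have "u (x + y) \<le> r x + r y"
            using u_le[OF r(1)] sublinear_add[OF sub(1)[OF r(1)]] order.trans by blast
          also have "\<dots> \<le> p x + p' y" using r by (intro add_mono) (auto simp: le_fun_def)
          finally show "u (x + y) - p' y \<le> p x" by simp
        qed
        then have "u (x + y) - u x \<le> u y" by (intro u_ge) (simp add: algebra_simps)
        then show "u (x + y) \<le> u x + u y" by simp
      next
        fix t :: real and x assume t: "0 < t"
        have "u (t *\<^sub>R x) / t \<le> u x"
          using u_le[of _ "t *\<^sub>R x"] sublinear_scale[OF sub(1), of _ t x] t
          by (intro u_ge) (simp add: field_simps)
        then show "u (t *\<^sub>R x) \<le> t * u x" using t by (simp add: field_simps)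
      next
        obtain p where "p \<in> C" using False by blast
        then show "u 0 = 0"
          using u_le[of p 0] u_ge[of 0 0] sublinear_zero[OF sub(1)] by fastforce
      qed
      moreover have "u \<le> p0" using False u_le sub(2) by (meson all_not_in_conv le_funI le_funE order.trans)
      ultimately show ?thesis using u_le by (auto simp: A_def le_fun_def)
    qed
  qed
  then obtain p where "p \<in> A" "\<And>a. a \<in> A \<Longrightarrow> a \<le> p \<Longrightarrow> a = p" by blast
  then show ?thesis using that by (auto simp: A_def)
qed

text \<open>Tilting in any direction \<open>x\<close> cannot make a minimal functional smaller, so it is odd at \<open>x\<close>; an odd
  sublinear functional is linear.\<close>
lemma linear_if_minimal_sublinear:
  assumes p: "sublinear p" and min: "\<And>p'. sublinear p' \<Longrightarrow> p' \<le> p \<Longrightarrow> p' = p"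
  shows "linear p"
proof
  have neg: "p (- x) = - p x" for x
  proof -
    have "tilt p x = p"
      using sublinear_tilt[OF p] tilt_le_self[OF p] by (intro min) (auto simp: le_fun_def)
    then have "p (- x) \<le> - p x" using tilt_minus[OF p, of x] by simp
    then show ?thesis using sublinear_minus[OF p, of x] by simp
  qed
  show "p (x + y) = p x + p y" for x y
    using sublinear_add[OF p, of x y] sublinear_add[OF p, of "- x" "- y"] neg[of "x + y"]
    by (simp add: neg)
  show "p (r *\<^sub>R x) = r *\<^sub>R p x" for r x
  proof (cases "0 \<le> r")
    case False
    then have "p ((- r) *\<^sub>R x) = - r * p x" by (intro sublinear_scale[OF p]) simp
    then show ?thesis by (simp add: neg)
  qed (simp add: sublinear_scale[OF p])
qed

text \<open>A minimal functional below the norm tilted towards \<open>z\<close> is forced to take the value \<open>norm z\<close> at \<open>z\<close>.\<close>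
lemma ex_real_norming_functional:
  fixes z :: "'a::real_normed_vector"
  obtains f :: "'a \<Rightarrow> real" where "linear f" "\<And>x. f x \<le> norm x" "f z = norm z"
proof -
  have n: "sublinear (norm :: 'a \<Rightarrow> real)"
    by (intro sublinearI) (auto simp: norm_triangle_ineq)
  obtain f where f: "sublinear f" "f \<le> tilt norm z" "\<And>p'. sublinear p' \<Longrightarrow> p' \<le> f \<Longrightarrow> p' = f"
    using ex_minimal_sublinear[OF sublinear_tilt[OF n]] by blast
  have lin: "linear f" using linear_if_minimal_sublinear f by blast
  have le: "f x \<le> norm x" for x
    using f(2) tilt_le_self[OF n, of z x] by (meson le_funE order.trans)
  have "f (- z) \<le> - norm z"
    using f(2) tilt_minus[OF n, of z] by (meson le_funE order.trans)
  then have "f z = norm z" using le[of z] linear_neg[OF lin, of z] by simp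
  then show ?thesis by (rule that[OF lin le])
qed

lemma complex_functionalI:
  fixes \<phi> :: "'a::complex_normed_vector \<Rightarrow> complex"
  assumes "\<And>x y. \<phi> (x + y) = \<phi> x + \<phi> y" "\<And>c x. \<phi> (c *\<^sub>C x) = c * \<phi> x"
  shows "Vector_Spaces.linear scaleC (*) \<phi>"
  by (unfold_locales) (auto simp: assms algebra_simps)

text \<open>The real functional is complexified in the usual way; a rotation of the argument
  shows that this does not increase its norm.\<close>
theorem ex_norming_functional:
  fixes z :: "'a::complex_normed_vector"
  obtains \<phi> where "Vector_Spaces.linear scaleC (*) \<phi>" "\<And>x. cmod (\<phi> x) \<le> norm x" "\<phi> z = norm z"
proof -
  obtain f where f: "linear f" "\<And>x. f x \<le> norm x" "f z = norm z"
    using ex_real_norming_functional[of z] by blast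
  define \<phi> where "\<phi> = (\<lambda>x. Complex (f x) (- f (\<i> *\<^sub>C x)))"
  have fR: "f (complex_of_real r *\<^sub>C x) = r * f x" for r x
    by (simp add: scaleC_of_real linear_scale[OF f(1)])
  have fi: "f (c *\<^sub>C x) = Re c * f x + Im c * f (\<i> *\<^sub>C x)" for c x
  proof -
    have "c *\<^sub>C x = complex_of_real (Re c) *\<^sub>C x + complex_of_real (Im c) *\<^sub>C \<i> *\<^sub>C x"
      by (metis complex_eq mult.commute scaleC_add_left scaleC_scaleC)
    then have "f (c *\<^sub>C x) = f (complex_of_real (Re c) *\<^sub>C x + complex_of_real (Im c) *\<^sub>C \<i> *\<^sub>C x)"
      by (rule arg_cong)
    then show ?thesis
      unfolding linear_add[OF f(1)] fR .
  qed
  have lin: "Vector_Spaces.linear scaleC (*) \<phi>"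
  proof (rule complex_functionalI)
    show "\<phi> (x + y) = \<phi> x + \<phi> y" for x y
      by (simp add: \<phi>_def complex_eq_iff scaleC_add_right linear_add[OF f(1)])
    show "\<phi> (c *\<^sub>C x) = c * \<phi> x" for c x
      using fi[of c x] fi[of "\<i> * c" x]
      by (simp add: \<phi>_def complex_eq_iff scaleC_scaleC algebra_simps)
  qed
  have le: "cmod (\<phi> x) \<le> norm x" for x
  proof (cases "\<phi> x = 0")
    case False
    define c where "c = cnj (sgn (\<phi> x))"
    have c: "cmod c = 1" using False by (simp add: c_def norm_sgn)
    have "\<phi> (c *\<^sub>C x) = c * \<phi> x" using lin by (simp add: Vector_Spaces.linear_iff)
    also have "\<dots> = cmod (\<phi> x)"
      using False complex_norm_square[of "\<phi> x"]
      by (simp add: c_def sgn_div_norm scaleR_conv_of_real field_simps power2_eq_square)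
    finally have "f (c *\<^sub>C x) = cmod (\<phi> x)" by (simp add: \<phi>_def complex_eq_iff)
    then show ?thesis using f(2)[of "c *\<^sub>C x"] c by (simp add: norm_scaleC)
  qed simp
  have "Re (\<phi> z) = norm z" by (simp add: \<phi>_def f)
  moreover have "Im (\<phi> z) = 0"
  proof -
    have "(norm z)\<^sup>2 + (Im (\<phi> z))\<^sup>2 \<le> (norm z)\<^sup>2"
      using power_mono[OF le[of z] norm_ge_zero, of 2] calculation
      by (simp add: cmod_power2)
    then show ?thesis by simp
  qed
  ultimately have "\<phi> z = norm z" by (simp add: complex_eq_iff)
  then show ?thesis by (rule that[OF lin le])
qed

section \<open>Continuous operators and functionals\<close>

lemma bounded_lipschitz_image:
  fixes h :: "'a::real_normed_vector \<Rightarrow> 'b::real_normed_vector"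
  assumes "bounded (f ` D)" "\<And>x y. norm (h x - h y) \<le> C * norm (x - y)"
  shows "bounded ((\<lambda>a. h (f a)) ` D)"
proof -
  obtain b where b: "\<And>a. a \<in> D \<Longrightarrow> norm (f a) \<le> b" using assms(1) unfolding bounded_iff by blast
  have "norm (h (f a)) \<le> \<bar>C\<bar> * b + norm (h 0)" if "a \<in> D" for a
  proof -
    have "norm (h (f a)) \<le> norm (h (f a) - h 0) + norm (h 0)"
      using norm_triangle_sub[of "h (f a)" "h 0"] by simp
    also have "norm (h (f a) - h 0) \<le> \<bar>C\<bar> * norm (f a)"
      using assms(2)[of "f a" 0] mult_right_mono[OF abs_ge_self[of C] norm_ge_zero[of "f a"]] by simp
    also have "\<bar>C\<bar> * norm (f a) \<le> \<bar>C\<bar> * b" using b[OF that] by (intro mult_left_mono) auto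
    finally show ?thesis by simp
  qed
  then show ?thesis unfolding bounded_iff by blast
qed

lemma continuous_operator_add: "continuous_operator T \<Longrightarrow> T (x + y) = T x + T y"
  by (simp add: continuous_operator_def Vector_Spaces.linear_iff)

lemma continuous_operator_scale: "continuous_operator T \<Longrightarrow> T (c *\<^sub>C x) = c *\<^sub>C T x"
  by (simp add: continuous_operator_def Vector_Spaces.linear_iff)

lemma continuous_operator_zero: "continuous_operator T \<Longrightarrow> T 0 = 0"
  using continuous_operator_scale[of T 0 0] by simp

lemma continuous_operator_diff: "continuous_operator T \<Longrightarrow> T (x - y) = T x - T y"
  using continuous_operator_add[of T "x - y" y] by simp

lemma continuous_operator_bounded:
  fixes T :: "'a::complex_normed_vector \<Rightarrow> 'a"
  assumes T: "continuous_operator T"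
  obtains C where "0 \<le> C" "\<And>x. norm (T x) \<le> C * norm x"
proof -
  have "isCont T 0"
    using T by (simp add: continuous_operator_def continuous_on_eq_continuous_at)
  then obtain d where d: "0 < d" "\<And>x. norm x < d \<Longrightarrow> norm (T x) < 1"
    using continuous_operator_zero[OF T] unfolding continuous_at_eps_delta
    by (auto simp: dist_norm dest: spec[of _ 1])
  have "norm (T x) \<le> 2 / d * norm x" for x
  proof (cases "x = 0")
    case False
    define t where "t = d / (2 * norm x)"
    have t: "0 < t" using d False by (simp add: t_def)
    have "norm (complex_of_real t *\<^sub>C x) < d"
      unfolding scaleC_of_real using d False by (simp add: t_def)
    then have "t * norm (T x) < 1"
      using d(2)[of "complex_of_real t *\<^sub>C x"] t
      by (simp add: continuous_operator_scale[OF T] norm_scaleC)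
    then show ?thesis using d False by (simp add: t_def field_simps)
  qed (simp add: continuous_operator_zero[OF T])
  then show ?thesis using that[of "2 / d"] d by auto
qed

lemma continuous_operatorI:
  fixes T :: "'a::complex_normed_vector \<Rightarrow> 'a"
  assumes "\<And>x y. T (x + y) = T x + T y" "\<And>c x. T (c *\<^sub>C x) = c *\<^sub>C T x"
    and C: "\<And>x. norm (T x) \<le> C * norm x"
  shows "continuous_operator T"
proof -
  have diff: "T (x - y) = T x - T y" for x y
    using assms(1)[of "x - y" y] by simp
  have "norm (T x - T y) \<le> \<bar>C\<bar> * norm (x - y)" for x y
    using C[of "x - y"] mult_right_mono[OF abs_ge_self[of C] norm_ge_zero[of "x - y"]]
    unfolding diff by linarith
  then have "continuous_on UNIV T"
    by (intro lipschitz_on_continuous_on[of "\<bar>C\<bar>"] lipschitz_onI) (auto simp: dist_norm)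
  moreover have "Vector_Spaces.linear scaleC scaleC T"
    using assms by (simp add: Vector_Spaces.linear_iff complex_vector.vector_space_axioms)
  ultimately show ?thesis by (simp add: continuous_operator_def)
qed

lemma continuous_operator_lipschitz:
  assumes "continuous_operator T"
  obtains C where "0 \<le> C" "\<And>x y. norm (T x - T y) \<le> C * norm (x - y)"
proof -
  obtain C where "0 \<le> C" "\<And>x. norm (T x) \<le> C * norm x"
    using continuous_operator_bounded[OF assms] by blast
  then show ?thesis using that[of C] by (simp flip: continuous_operator_diff[OF assms])
qed

lemma continuous_operator_plus:
  assumes A: "continuous_operator A" and B: "continuous_operator B"
  shows "continuous_operator (\<lambda>x. A x + B x)"
proof -
  obtain C where C: "\<And>x. norm (A x) \<le> C * norm x" using continuous_operator_bounded[OF A] by blast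
  obtain D where D: "\<And>x. norm (B x) \<le> D * norm x" using continuous_operator_bounded[OF B] by blast
  show ?thesis
  proof (rule continuous_operatorI)
    show "norm (A x + B x) \<le> (C + D) * norm x" for x
      using norm_triangle_ineq[of "A x" "B x"] C[of x] D[of x] by (simp add: distrib_right)
  qed (simp_all add: continuous_operator_add[OF A] continuous_operator_add[OF B]
      continuous_operator_scale[OF A] continuous_operator_scale[OF B] scaleC_add_right)
qed

lemma continuous_operator_scaled:
  assumes A: "continuous_operator A"
  shows "continuous_operator (\<lambda>x. c *\<^sub>C A x)"
proof -
  obtain C where C: "\<And>x. norm (A x) \<le> C * norm x" using continuous_operator_bounded[OF A] by blast
  show ?thesis
  proof (rule continuous_operatorI)
    show "norm (c *\<^sub>C A x) \<le> (cmod c * C) * norm x" for x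
      using mult_left_mono[OF C, of "cmod c"] by (simp add: norm_scaleC mult.assoc)
  qed (simp_all add: continuous_operator_add[OF A] continuous_operator_scale[OF A]
      scaleC_add_right scaleC_scaleC mult.commute)
qed

lemma continuous_operator_id: "continuous_operator (\<lambda>x. x)"
  by (rule continuous_operatorI[where C = 1]) auto

lemma bounded_continuous_operator_image:
  assumes "continuous_operator T" "bounded (f ` D)"
  shows "bounded ((\<lambda>a. T (f a)) ` D)"
  using continuous_operator_lipschitz[OF assms(1)] bounded_lipschitz_image[OF assms(2)] by metis

definition continuous_functional :: "('a::complex_normed_vector \<Rightarrow> complex) \<Rightarrow> bool" where
  "continuous_functional \<phi> \<longleftrightarrow>
    Vector_Spaces.linear scaleC (*) \<phi> \<and> (\<exists>C. \<forall>x. cmod (\<phi> x) \<le> C * norm x)"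

lemma functional_add: "continuous_functional \<phi> \<Longrightarrow> \<phi> (x + y) = \<phi> x + \<phi> y"
  by (simp add: continuous_functional_def Vector_Spaces.linear_iff)

lemma functional_scale: "continuous_functional \<phi> \<Longrightarrow> \<phi> (c *\<^sub>C x) = c * \<phi> x"
  by (simp add: continuous_functional_def Vector_Spaces.linear_iff)

lemma functional_zero: "continuous_functional \<phi> \<Longrightarrow> \<phi> 0 = 0"
  using functional_scale[of \<phi> 0 0] by simp

lemma functional_diff: "continuous_functional \<phi> \<Longrightarrow> \<phi> (x - y) = \<phi> x - \<phi> y"
  using functional_add[of \<phi> "x - y" y] by simp

lemma functional_sum: "continuous_functional \<phi> \<Longrightarrow> \<phi> (\<Sum>i\<in>A. f i) = (\<Sum>i\<in>A. \<phi> (f i))"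
  by (induction A rule: infinite_finite_induct) (simp_all add: functional_zero functional_add)

lemma functional_lipschitz:
  assumes "continuous_functional \<phi>"
  obtains C where "0 \<le> C" "\<And>x y. norm (\<phi> x - \<phi> y) \<le> C * norm (x - y)"
proof -
  obtain C where C: "\<And>x. cmod (\<phi> x) \<le> C * norm x"
    using assms unfolding continuous_functional_def by blast
  have "norm (\<phi> x - \<phi> y) \<le> \<bar>C\<bar> * norm (x - y)" for x y
    using C[of "x - y"] mult_right_mono[OF abs_ge_self[of C] norm_ge_zero[of "x - y"]]
    unfolding functional_diff[OF assms] by linarith
  then show ?thesis using that[of "\<bar>C\<bar>"] by simp
qed

lemma subspace_kernel: "continuous_functional \<phi> \<Longrightarrow> complex_vector.subspace {x. \<phi> x = 0}"
  by (simp add: complex_vector.subspace_def functional_zero functional_add functional_scale)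

lemma closed_kernel:
  assumes "continuous_functional \<phi>"
  shows "closed {x. \<phi> x = 0}"
proof -
  obtain C where "0 \<le> C" "\<And>x y. norm (\<phi> x - \<phi> y) \<le> C * norm (x - y)"
    using functional_lipschitz[OF assms] by blast
  then have "continuous_on UNIV \<phi>"
    by (intro lipschitz_on_continuous_on[of C] lipschitz_onI) (auto simp: dist_norm)
  then show ?thesis by (intro closed_Collect_eq continuous_on_const)
qed

lemma closed_subspace_closure:
  fixes S :: "'a::complex_normed_vector set"
  assumes S: "complex_vector.subspace S"
  shows "complex_vector.subspace (closure S)"
  unfolding complex_vector.subspace_def
proof (intro conjI ballI allI)
  show "0 \<in> closure S"
    using complex_vector.subspace_0[OF S] closure_subset by blast
next
  fix x y assume "x \<in> closure S" "y \<in> closure S"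
  then obtain f g where "\<And>n. f n \<in> S" "f \<longlonglongrightarrow> x" "\<And>n. g n \<in> S" "g \<longlonglongrightarrow> y"
    unfolding closure_sequential by blast
  then show "x + y \<in> closure S"
    unfolding closure_sequential
    by (intro exI[of _ "\<lambda>n. f n + g n"]) (auto intro: tendsto_add complex_vector.subspace_add[OF S])
next
  fix c and x assume "x \<in> closure S"
  then obtain f where f: "\<And>n. f n \<in> S" "f \<longlonglongrightarrow> x" unfolding closure_sequential by blast
  have "(\<lambda>n. norm (c *\<^sub>C f n - c *\<^sub>C x)) \<longlonglongrightarrow> 0"
    unfolding complex_vector.scale_right_diff_distrib[symmetric] norm_scaleC
    by (intro tendsto_mult_right_zero tendsto_norm_zero LIM_zero f(2))
  then have "(\<lambda>n. c *\<^sub>C f n) \<longlonglongrightarrow> c *\<^sub>C x"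
    by (rule LIM_zero_cancel[OF tendsto_norm_zero_cancel])
  then show "c *\<^sub>C x \<in> closure S"
    unfolding closure_sequential using complex_vector.subspace_scale[OF S] f(1)
    by (intro exI[of _ "\<lambda>n. c *\<^sub>C f n"]) simp
qed

section \<open>Hausdorff measure of noncompactness\<close>

definition finite_net :: "'b set \<Rightarrow> ('b \<Rightarrow> 'a::real_normed_vector) \<Rightarrow> real \<Rightarrow> bool" where
  "finite_net D f r \<longleftrightarrow> (\<exists>F. finite F \<and> (\<forall>a\<in>D. \<exists>u\<in>F. norm (f a - u) \<le> r))"

text \<open>The condition \<open>0 \<le> r\<close> matters only for empty \<open>D\<close>, where every negative radius would qualify as well.\<close>
definition noncompactness :: "'b set \<Rightarrow> ('b \<Rightarrow> 'a::real_normed_vector) \<Rightarrow> real" where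
  "noncompactness D f = Inf {r. 0 \<le> r \<and> finite_net D f r}"

lemma finite_net_mono: "finite_net D f r \<Longrightarrow> r \<le> s \<Longrightarrow> finite_net D f s"
  unfolding finite_net_def by (fast intro: order.trans)

lemma noncompactness_le: "0 \<le> r \<Longrightarrow> finite_net D f r \<Longrightarrow> noncompactness D f \<le> r"
  unfolding noncompactness_def by (intro cInf_lower) (auto simp: bdd_below_def)

lemma ex_finite_net:
  assumes "bounded (f ` D)"
  shows "\<exists>r\<ge>0. finite_net D f r"
proof -
  obtain b where "0 < b" "\<And>a. a \<in> D \<Longrightarrow> norm (f a) \<le> b"
    using assms unfolding bounded_pos by blast
  then have "finite_net D f b" unfolding finite_net_def by (intro exI[of _ "{0}"]) auto
  then show ?thesis using \<open>0 < b\<close> less_imp_le by blast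
qed

lemma finite_net_noncompactness:
  assumes "bounded (f ` D)" "noncompactness D f < r"
  shows "finite_net D f r"
proof -
  obtain s where "finite_net D f s" "s < r"
    using cInf_lessD[of "{r. 0 \<le> r \<and> finite_net D f r}" r] assms ex_finite_net[OF assms(1)]
    unfolding noncompactness_def by auto
  then show ?thesis using finite_net_mono[of D f s r] by simp
qed

lemma noncompactness_nonneg:
  assumes "bounded (f ` D)"
  shows "0 \<le> noncompactness D f"
  unfolding noncompactness_def using ex_finite_net[OF assms] by (intro cInf_greatest) auto

lemma noncompactness_add:
  assumes f: "bounded (f ` D)" and g: "bounded (g ` D)"
  shows "noncompactness D (\<lambda>a. f a + g a) \<le> noncompactness D f + noncompactness D g"
proof (rule field_le_epsilon)
  fix e :: real assume e: "0 < e"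
  have "finite_net D f (noncompactness D f + e / 2)" "finite_net D g (noncompactness D g + e / 2)"
    using e by (auto intro!: finite_net_noncompactness assms)
  then obtain F G where F: "finite F" "\<forall>a\<in>D. \<exists>u\<in>F. norm (f a - u) \<le> noncompactness D f + e / 2"
    and G: "finite G" "\<forall>a\<in>D. \<exists>u\<in>G. norm (g a - u) \<le> noncompactness D g + e / 2"
    unfolding finite_net_def by blast
  have "finite_net D (\<lambda>a. f a + g a) (noncompactness D f + noncompactness D g + e)"
    unfolding finite_net_def
  proof (intro exI[of _ "(\<lambda>(u, v). u + v) ` (F \<times> G)"] conjI ballI)
    fix a assume "a \<in> D"
    then obtain u v where uv: "u \<in> F" "norm (f a - u) \<le> noncompactness D f + e / 2"
      "v \<in> G" "norm (g a - v) \<le> noncompactness D g + e / 2" using F G by blast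
    then have "norm (f a + g a - (u + v)) \<le> noncompactness D f + noncompactness D g + e"
      using norm_diff_triangle_ineq[of "f a" "g a" u v] by simp
    then show "\<exists>w\<in>(\<lambda>(u, v). u + v) ` (F \<times> G). norm (f a + g a - w)
        \<le> noncompactness D f + noncompactness D g + e"
      using uv by (intro bexI[of _ "u + v"]) auto
  qed (use F G in auto)
  then show "noncompactness D (\<lambda>a. f a + g a) \<le> noncompactness D f + noncompactness D g + e"
    using e noncompactness_nonneg[OF f] noncompactness_nonneg[OF g] by (intro noncompactness_le) auto
qed

text \<open>The image of a finite net under \<open>h\<close> is a finite net whose radius has grown by the factor \<open>C\<close>.\<close>
lemma noncompactness_lipschitz:
  assumes f: "bounded (f ` D)" and C: "0 \<le> C" "\<And>x y. norm (h x - h y) \<le> C * norm (x - y)"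
  shows "noncompactness D (\<lambda>a. h (f a)) \<le> C * noncompactness D f"
proof (rule field_le_epsilon)
  fix e :: real assume e: "0 < e"
  define r where "r = noncompactness D f + e / (C + 1)"
  have "finite_net D f r"
    unfolding r_def using e C by (intro finite_net_noncompactness f) auto
  then obtain F where F: "finite F" "\<forall>a\<in>D. \<exists>u\<in>F. norm (f a - u) \<le> r"
    unfolding finite_net_def by blast
  have "finite_net D (\<lambda>a. h (f a)) (C * r)"
    unfolding finite_net_def
  proof (intro exI[of _ "h ` F"] conjI ballI)
    fix a assume "a \<in> D"
    then obtain u where u: "u \<in> F" "norm (f a - u) \<le> r" using F by blast
    then have "norm (h (f a) - h u) \<le> C * r"
      using C mult_left_mono order.trans by blast
    then show "\<exists>w\<in>h ` F. norm (h (f a) - w) \<le> C * r" using u by blast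
  qed (use F in auto)
  moreover have "0 \<le> C * r" using e C noncompactness_nonneg[OF f] by (simp add: r_def)
  ultimately have "noncompactness D (\<lambda>a. h (f a)) \<le> C * r" by (intro noncompactness_le)
  also have "C * r \<le> C * noncompactness D f + e"
  proof -
    have "C * (e / (C + 1)) \<le> e" using e C by (simp add: field_simps)
    then show ?thesis by (simp add: r_def distrib_left)
  qed
  finally show "noncompactness D (\<lambda>a. h (f a)) \<le> C * noncompactness D f + e" .
qed

lemma noncompactness_scaleC:
  fixes f :: "'b \<Rightarrow> 'a::complex_normed_vector"
  assumes f: "bounded (f ` D)"
  shows "noncompactness D (\<lambda>a. k *\<^sub>C f a) = cmod k * noncompactness D f"
proof -
  have lip: "norm (k *\<^sub>C x - k *\<^sub>C y) \<le> cmod k * norm (x - y)" for k and x y :: 'a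
    by (simp add: norm_scaleC flip: complex_vector.scale_right_diff_distrib)
  have le: "noncompactness D (\<lambda>a. k *\<^sub>C f a) \<le> cmod k * noncompactness D f"
    using noncompactness_lipschitz[OF f, of "cmod k" "scaleC k"] lip by simp
  show ?thesis
  proof (cases "k = 0")
    case True
    then show ?thesis using le noncompactness_nonneg[OF bounded_lipschitz_image[OF f lip], of k] by simp
  next
    case False
    have "noncompactness D (\<lambda>a. (1 / k) *\<^sub>C k *\<^sub>C f a)
        \<le> cmod (1 / k) * noncompactness D (\<lambda>a. k *\<^sub>C f a)"
      using noncompactness_lipschitz[OF bounded_lipschitz_image[OF f lip], of "cmod (1 / k)" "scaleC (1 / k)" k] lip
      by simp
    then show ?thesis using le False by (simp add: scaleC_scaleC norm_divide field_simps)
  qed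
qed

text \<open>In a complete space a set is relatively compact iff it has finite nets of every positive radius.\<close>
lemma compact_operator_iff_noncompactness:
  fixes K :: "'a::complex_banach \<Rightarrow> 'a"
  assumes K: "continuous_operator K"
  shows "compact_operator K \<longleftrightarrow> (\<forall>S. bounded S \<longrightarrow> noncompactness S K = 0)"
proof -
  obtain C where C: "0 \<le> C" "\<And>x. norm (K x) \<le> C * norm x" using continuous_operator_bounded[OF K] by blast
  have "compact (closure (K ` S)) \<longleftrightarrow> noncompactness S K = 0" if S: "bounded S" for S
  proof -
    have bd: "bounded (K ` S)"
      using bounded_lipschitz_image[of "\<lambda>x. x" S K C] S C(2)
      by (simp flip: continuous_operator_diff[OF K])
    show ?thesis
    proof
      assume cpt: "compact (closure (K ` S))"
      have "noncompactness S K \<le> 0 + e" if e: "0 < e" for e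
      proof -
        obtain F where F: "finite F" "closure (K ` S) \<subseteq> (\<Union>u\<in>F. ball u e)"
          using cpt e unfolding compact_eq_totally_bounded by blast
        have "finite_net S K e"
          unfolding finite_net_def
        proof (intro exI[of _ F] conjI ballI F(1))
          fix a assume "a \<in> S"
          then have "K a \<in> closure (K ` S)" by (meson closure_subset imageI subsetD)
          then obtain u where "u \<in> F" "dist u (K a) < e" using F by auto
          then show "\<exists>u\<in>F. norm (K a - u) \<le> e"
            by (intro bexI[of _ u]) (auto simp: dist_norm norm_minus_commute)
        qed
        then show ?thesis using e by (simp add: noncompactness_le)
      qed
      then show "noncompactness S K = 0"
        using field_le_epsilon[of "noncompactness S K" 0] noncompactness_nonneg[OF bd] by simp
    next
      assume nc: "noncompactness S K = 0"
      show "compact (closure (K ` S))"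
        unfolding compact_eq_totally_bounded
      proof (intro conjI allI impI)
        show "complete (closure (K ` S))" by (simp add: complete_eq_closed)
        fix e :: real assume e: "0 < e"
        have "finite_net S K (e / 2)"
          using nc e by (intro finite_net_noncompactness bd) simp
        then obtain F where F: "finite F" "\<forall>a\<in>S. \<exists>u\<in>F. norm (K a - u) \<le> e / 2"
          unfolding finite_net_def by blast
        have "K ` S \<subseteq> (\<Union>u\<in>F. cball u (e / 2))"
          using F(2) by (fastforce simp: dist_norm norm_minus_commute)
        moreover have "closed (\<Union>u\<in>F. cball u (e / 2))" using F(1) by (intro closed_UN) auto
        ultimately have "closure (K ` S) \<subseteq> (\<Union>u\<in>F. cball u (e / 2))" by (rule closure_minimal)
        also have "\<dots> \<subseteq> (\<Union>u\<in>F. ball u e)" using e by (intro UN_mono subsetI) auto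
        finally show "\<exists>k. finite k \<and> closure (K ` S) \<subseteq> (\<Union>x\<in>k. ball x e)" using F(1) by blast
      qed
    qed
  qed
  then show ?thesis using K by (auto simp: compact_operator_def)
qed

instance complex_banach \<subseteq> banach ..

lemma noncompactness_compact_operator:
  fixes P :: "'a::complex_banach \<Rightarrow> 'a"
  assumes P: "compact_operator P" and f: "bounded (f ` D)"
  shows "noncompactness D (\<lambda>a. P (f a)) = 0"
proof -
  have "noncompactness D (\<lambda>a. P (f a)) = noncompactness (f ` D) P"
    by (simp add: noncompactness_def finite_net_def)
  moreover have "continuous_operator P" using P by (simp add: compact_operator_def)
  ultimately show ?thesis using P f compact_operator_iff_noncompactness by metis
qed

lemma compact_operator_plus:
  fixes A :: "'a::complex_banach \<Rightarrow> 'a"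
  assumes A: "compact_operator A" and B: "compact_operator B"
  shows "compact_operator (\<lambda>x. A x + B x)"
proof -
  have cont: "continuous_operator A" "continuous_operator B"
    using A B by (auto simp: compact_operator_def)
  have "noncompactness S (\<lambda>x. A x + B x) = 0" if S: "bounded S" for S
  proof -
    have AB: "bounded (A ` S)" "bounded (B ` S)"
      using bounded_continuous_operator_image[of _ "\<lambda>x. x" S] cont S by auto
    have "noncompactness S A = 0" "noncompactness S B = 0"
      using A B cont S compact_operator_iff_noncompactness by auto
    then have "noncompactness S (\<lambda>x. A x + B x) \<le> 0"
      using noncompactness_add[OF AB] by simp
    moreover have "0 \<le> noncompactness S (\<lambda>x. A x + B x)"
      by (intro noncompactness_nonneg bounded_plus_comp AB)
    ultimately show ?thesis by simp
  qed
  then show ?thesis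
    using compact_operator_iff_noncompactness[OF continuous_operator_plus[OF cont]] by blast
qed

lemma compact_operator_rank_one:
  fixes v :: "'a::complex_normed_vector"
  assumes \<phi>: "continuous_functional \<phi>"
  shows "compact_operator (\<lambda>x. \<phi> x *\<^sub>C v)"
proof -
  obtain C where C: "0 \<le> C" "\<And>x y. norm (\<phi> x - \<phi> y) \<le> C * norm (x - y)"
    using functional_lipschitz[OF \<phi>] by blast
  have cont: "continuous_operator (\<lambda>x. \<phi> x *\<^sub>C v)"
  proof (rule continuous_operatorI)
    show "norm (\<phi> x *\<^sub>C v) \<le> (C * norm v) * norm x" for x
      using mult_right_mono[OF C(2)[of x 0] norm_ge_zero[of v]]
      by (simp add: norm_scaleC functional_zero[OF \<phi>] mult_ac)
  qed (simp_all add: functional_add[OF \<phi>] functional_scale[OF \<phi>] scaleC_add_left scaleC_scaleC)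
  have "compact (closure ((\<lambda>x. \<phi> x *\<^sub>C v) ` S))" if S: "bounded S" for S
  proof -
    have "bounded (\<phi> ` S)"
      using bounded_lipschitz_image[of "\<lambda>x. x" S \<phi> C] S C(2) by simp
    then have "compact (closure (\<phi> ` S))" by simp
    moreover have "continuous_on (closure (\<phi> ` S)) (\<lambda>c. c *\<^sub>C v)"
      by (intro lipschitz_on_continuous_on[of "norm v"] lipschitz_onI)
        (auto simp: dist_norm norm_scaleC simp flip: complex_vector.scale_left_diff_distrib)
    ultimately have cpt: "compact ((\<lambda>c. c *\<^sub>C v) ` closure (\<phi> ` S))"
      by (intro compact_continuous_image)
    have "(\<lambda>x. \<phi> x *\<^sub>C v) ` S \<subseteq> (\<lambda>c. c *\<^sub>C v) ` closure (\<phi> ` S)"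
      using closure_subset[of "\<phi> ` S"] by auto
    then have "closure ((\<lambda>x. \<phi> x *\<^sub>C v) ` S) \<subseteq> (\<lambda>c. c *\<^sub>C v) ` closure (\<phi> ` S)"
      using compact_imp_closed[OF cpt] by (intro closure_minimal)
    then show ?thesis using cpt closed_closure compact_Int_closed[OF cpt, of "closure ((\<lambda>x. \<phi> x *\<^sub>C v) ` S)"]
      by (simp add: Int_absorb1)
  qed
  then show ?thesis using cont by (simp add: compact_operator_def)
qed

lemma compact_operator_zero: "compact_operator (\<lambda>x::'a::complex_normed_vector. 0)"
proof -
  have "continuous_operator (\<lambda>x::'a. 0)" by (rule continuous_operatorI[where C = 0]) auto
  moreover have "compact (closure ((\<lambda>x::'a. 0 :: 'a) ` S))" for S
    by (cases "S = {}") (simp_all add: image_constant_conv)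
  ultimately show ?thesis unfolding compact_operator_def by blast
qed

lemma compact_operator_sum:
  fixes A :: "nat \<Rightarrow> 'a::complex_banach \<Rightarrow> 'a"
  assumes "\<And>i. i < n \<Longrightarrow> compact_operator (A i)"
  shows "compact_operator (\<lambda>x. \<Sum>i<n. A i x)"
  using assms by (induction n) (simp_all add: compact_operator_zero compact_operator_plus)

text \<open>A convergent majorant makes the finite partial sums approximate the series uniformly on bounded
  sets, so the measure of noncompactness of the sum is at most that of an arbitrarily small tail.\<close>
lemma compact_operator_suminf:
  fixes A :: "nat \<Rightarrow> 'a::complex_banach \<Rightarrow> 'a"
  assumes A: "\<And>n. compact_operator (A n)"
    and b: "summable b" "\<And>n x. norm (A n x) \<le> b n * norm x"
  shows "compact_operator (\<lambda>x. \<Sum>n. A n x)"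
proof -
  have cont: "continuous_operator (A n)" for n using A by (simp add: compact_operator_def)
  have bx: "summable (\<lambda>n. b n * norm x)" for x using b(1) by (intro summable_mult2)
  have sums: "summable (\<lambda>n. A n x)" for x
    using b(2) by (intro summable_comparison_test'[OF bx[of x], of 0]) auto
  have tail: "norm (\<Sum>i. A (i + N) x) \<le> (\<Sum>i. b (i + N)) * norm x" for N x
  proof -
    have "norm (\<Sum>i. A (i + N) x) \<le> (\<Sum>i. b (i + N) * norm x)"
      using b(2) summable_iff_shift[of "\<lambda>n. b n * norm x" N] bx[of x]
      by (intro norm_suminf_le) auto
    also have "\<dots> = (\<Sum>i. b (i + N)) * norm x"
      using b(1) summable_iff_shift[of b N] by (intro suminf_mult2[symmetric]) auto
    finally show ?thesis .
  qed
  have K: "continuous_operator (\<lambda>x. \<Sum>n. A n x)"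
  proof (rule continuous_operatorI)
    show "(\<Sum>n. A n (x + y)) = (\<Sum>n. A n x) + (\<Sum>n. A n y)" for x y
      by (simp add: continuous_operator_add[OF cont] suminf_add[OF sums sums])
    have "bounded_linear (scaleC c :: 'a \<Rightarrow> 'a)" for c
      by (rule bounded_linear_intro[where K = "cmod c"])
        (simp_all add: scaleC_add_right norm_scaleC scaleC_scaleC mult.commute flip: scaleC_of_real)
    then show "(\<Sum>n. A n (c *\<^sub>C x)) = c *\<^sub>C (\<Sum>n. A n x)" for c x
      unfolding continuous_operator_scale[OF cont] by (rule bounded_linear.suminf[OF _ sums, symmetric])
    show "norm (\<Sum>n. A n x) \<le> (\<Sum>i. b i) * norm x" for x
      using tail[of 0] by simp
  qed
  have "noncompactness S (\<lambda>x. \<Sum>n. A n x) = 0" if S: "bounded S" for S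
  proof -
    obtain M where M: "0 < M" "\<And>x. x \<in> S \<Longrightarrow> norm x \<le> M" using S unfolding bounded_pos by blast
    have "noncompactness S (\<lambda>x. \<Sum>n. A n x) \<le> 0 + e" if e: "0 < e" for e
    proof -
      obtain N where N: "norm (\<Sum>i. b (i + N)) < e / M"
        using suminf_exist_split[of "e / M" b] b(1) e M(1) by auto
      have head: "compact_operator (\<lambda>x. \<Sum>i<N. A i x)" by (rule compact_operator_sum[OF A])
      have "finite_net S (\<lambda>x. \<Sum>i. A (i + N) x) e"
        unfolding finite_net_def
      proof (intro exI[of _ "{0}"] conjI ballI)
        fix x assume x: "x \<in> S"
        have "norm (\<Sum>i. A (i + N) x) \<le> norm (\<Sum>i. b (i + N)) * norm x"
          using tail[of N x] mult_right_mono[OF abs_ge_self norm_ge_zero] by (fastforce intro: order.trans)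
        also have "\<dots> \<le> e / M * M" using N M(2)[OF x] by (intro mult_mono) auto
        finally show "\<exists>u\<in>{0}. norm ((\<Sum>i. A (i + N) x) - u) \<le> e" using M(1) by simp
      qed simp
      then have t: "noncompactness S (\<lambda>x. \<Sum>i. A (i + N) x) \<le> e"
        using e by (intro noncompactness_le) auto
      have h: "noncompactness S (\<lambda>x. \<Sum>i<N. A i x) = 0"
        using noncompactness_compact_operator[OF head, of "\<lambda>x. x" S] S by simp
      have bh: "bounded ((\<lambda>x. \<Sum>i<N. A i x) ` S)"
        using bounded_continuous_operator_image[of _ "\<lambda>x. x" S] head S
        by (auto simp: compact_operator_def)
      have eq: "(\<Sum>n. A n x) = (\<Sum>i<N. A i x) + (\<Sum>i. A (i + N) x)" for x
        using suminf_split_initial_segment[OF sums, of x N] by simp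
      have bt: "bounded ((\<lambda>x. \<Sum>i. A (i + N) x) ` S)"
      proof -
        have "bounded ((\<lambda>x. (\<Sum>n. A n x) - (\<Sum>i<N. A i x)) ` S)"
          using bounded_continuous_operator_image[OF K, of "\<lambda>x. x" S] S bh
          by (intro bounded_minus_comp) auto
        then show ?thesis by (simp add: eq)
      qed
      show ?thesis using noncompactness_add[OF bh bt] h t by (simp add: eq)
    qed
    then have "noncompactness S (\<lambda>x. \<Sum>n. A n x) \<le> 0" by (rule field_le_epsilon)
    moreover have "0 \<le> noncompactness S (\<lambda>x. \<Sum>n. A n x)"
      using bounded_continuous_operator_image[OF K, of "\<lambda>x. x" S] S by (intro noncompactness_nonneg) simp
    ultimately show ?thesis by simp
  qed
  then show ?thesis using compact_operator_iff_noncompactness[OF K] by blast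
qed

section \<open>Essential approximate eigenvalues\<close>

text \<open>Adjoining one vector \<open>a\<close> outside of a closed subspace \<open>V\<close> keeps it closed: the distance of \<open>a\<close> from
  \<open>V\<close> is positive and controls the coefficient of \<open>a\<close> along a convergent sequence.\<close>
lemma closed_span_finite:
  fixes B :: "'a::complex_normed_vector set"
  assumes "finite B"
  shows "closed (complex_vector.span B)"
  using assms
proof (induction B rule: finite_induct)
  case empty
  then show ?case by (simp add: complex_vector.span_empty)
next
  case (insert a B)
  let ?V = "complex_vector.span B"
  show ?case
  proof (cases "a \<in> ?V")
    case True
    then show ?thesis using insert.IH by (simp add: complex_vector.span_redundant)
  next
    case False
    define d where "d = infdist a ?V"
    have "?V \<noteq> {}" using complex_vector.span_zero by blast
    then have d: "0 < d"
      using insert.IH False by (simp add: d_def infdist_pos_not_in_closed)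
    have lower: "cmod k * d \<le> norm (k *\<^sub>C a + v)" if v: "v \<in> ?V" for k v
    proof (cases "k = 0")
      case False
      have "- ((1 / k) *\<^sub>C v) \<in> ?V"
        using v complex_vector.span_neg complex_vector.span_scale by blast
      then have "d \<le> norm (a + (1 / k) *\<^sub>C v)"
        using infdist_le[of "- ((1 / k) *\<^sub>C v)" ?V a] by (simp add: d_def dist_norm)
      then have "cmod k * d \<le> norm (k *\<^sub>C (a + (1 / k) *\<^sub>C v))"
        by (simp add: norm_scaleC mult_left_mono)
      then show ?thesis using False by (simp add: scaleC_add_right scaleC_scaleC)
    qed simp
    show ?thesis
      unfolding closed_sequential_limits
    proof (intro allI impI)
      fix x l assume "(\<forall>n. x n \<in> complex_vector.span (insert a B)) \<and> x \<longlonglongrightarrow> l"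
      then obtain k where k: "\<And>n. x n - k n *\<^sub>C a \<in> ?V" and lim: "x \<longlonglongrightarrow> l"
        unfolding complex_vector.span_breakdown_eq by metis
      have "Cauchy k"
        unfolding Cauchy_altdef2
      proof (intro allI impI)
        fix e :: real assume "0 < e"
        then obtain M where M: "\<And>n. n \<ge> M \<Longrightarrow> dist (x n) (x M) < d * e"
          using LIMSEQ_imp_Cauchy[OF lim] d unfolding Cauchy_altdef2 by (meson mult_pos_pos)
        have "dist (k n) (k M) < e" if "n \<ge> M" for n
        proof -
          have "cmod (k n - k M) * d
              \<le> norm ((k n - k M) *\<^sub>C a + ((x n - k n *\<^sub>C a) - (x M - k M *\<^sub>C a)))"
            by (intro lower complex_vector.span_diff k)
          also have "(k n - k M) *\<^sub>C a + ((x n - k n *\<^sub>C a) - (x M - k M *\<^sub>C a)) = x n - x M"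
            by (simp add: complex_vector.scale_left_diff_distrib)
          finally have "cmod (k n - k M) * d < e * d"
            using M[OF that] by (simp add: dist_norm mult.commute)
          then show ?thesis using d by (simp add: dist_norm)
        qed
        then show "\<exists>N. \<forall>n\<ge>N. dist (k n) (k N) < e" by blast
      qed
      then obtain m where m: "k \<longlonglongrightarrow> m" using Cauchy_convergent convergent_def by blast
      have "(\<lambda>n. norm (k n *\<^sub>C a - m *\<^sub>C a)) \<longlonglongrightarrow> 0"
        unfolding complex_vector.scale_left_diff_distrib[symmetric] norm_scaleC
        by (intro tendsto_mult_left_zero tendsto_norm_zero LIM_zero m)
      then have "(\<lambda>n. k n *\<^sub>C a) \<longlonglongrightarrow> m *\<^sub>C a"
        by (rule LIM_zero_cancel[OF tendsto_norm_zero_cancel])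
      then have "(\<lambda>n. x n - k n *\<^sub>C a) \<longlonglongrightarrow> l - m *\<^sub>C a" by (intro tendsto_diff lim)
      then have "l - m *\<^sub>C a \<in> ?V" by (rule closed_sequentially[OF insert.IH k])
      then show "l \<in> complex_vector.span (insert a B)"
        unfolding complex_vector.span_breakdown_eq by blast
    qed
  qed
qed

text \<open>Riesz's theorem. If finitely many vectors came within 1/2 of every point of the unit ball, rescaling and
  iterating would approximate every vector by elements of their span with an error that is halved
  each time; the span is closed, so it would be the whole space.\<close>
lemma noncompactness_unit_ball_pos:
  assumes "\<not> finite_dimensional (UNIV :: 'a::complex_normed_vector set)"
  shows "0 < noncompactness (cball (0::'a) 1) (\<lambda>x. x)"
proof (rule ccontr)
  assume "\<not> 0 < noncompactness (cball (0::'a) 1) (\<lambda>x. x)"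
  then have "finite_net (cball (0::'a) 1) (\<lambda>x. x) (1 / 2)"
    by (intro finite_net_noncompactness) auto
  then obtain F :: "'a set" where F: "finite F" "\<forall>a\<in>cball 0 1. \<exists>u\<in>F. norm (a - u) \<le> 1 / 2"
    unfolding finite_net_def by blast
  let ?V = "complex_vector.span F"
  have approx: "\<exists>y\<in>?V. norm (x - y) \<le> norm x / 2 ^ n" for x n
  proof (induction n)
    case 0
    then show ?case using complex_vector.span_zero by (intro bexI[of _ 0]) auto
  next
    case (Suc n)
    then obtain y where y: "y \<in> ?V" "norm (x - y) \<le> norm x / 2 ^ n" by blast
    define w where "w = x - y"
    show ?case
    proof (cases "w = 0")
      case True
      then show ?thesis using y by (intro bexI[of _ y]) (auto simp: w_def)
    next
      case False
      have "(1 / norm w) *\<^sub>R w \<in> cball 0 1" using False by simp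
      then obtain u where u: "u \<in> F" "norm ((1 / norm w) *\<^sub>R w - u) \<le> 1 / 2" using F(2) by blast
      have "norm (w - norm w *\<^sub>R u) = norm w * norm ((1 / norm w) *\<^sub>R w - u)"
        using norm_scaleR[of "norm w" "(1 / norm w) *\<^sub>R w - u"] False
        by (simp add: scaleR_diff_right)
      also have "\<dots> \<le> norm w * (1 / 2)" using u by (intro mult_left_mono) auto
      also have "\<dots> \<le> norm x / 2 ^ Suc n" using y by (simp add: w_def)
      finally have "norm (x - (y + complex_of_real (norm w) *\<^sub>C u)) \<le> norm x / 2 ^ Suc n"
        by (simp add: w_def scaleC_of_real algebra_simps)
      moreover have "y + complex_of_real (norm w) *\<^sub>C u \<in> ?V"
        using y(1) complex_vector.span_base[OF u(1)]
        by (intro complex_vector.span_add complex_vector.span_scale)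
      ultimately show ?thesis by blast
    qed
  qed
  have "x \<in> ?V" for x
  proof -
    obtain y where y: "\<And>n. y n \<in> ?V" "\<And>n. norm (x - y n) \<le> norm x / 2 ^ n"
      using approx by metis
    have "(\<lambda>n. norm x / 2 ^ n) \<longlonglongrightarrow> 0"
      by (rule LIMSEQ_divide_realpow_zero) simp
    moreover have "\<forall>\<^sub>F n in sequentially. norm (y n - x) \<le> norm x / 2 ^ n"
      using y(2) by (simp add: norm_minus_commute)
    ultimately have "(\<lambda>n. y n - x) \<longlonglongrightarrow> 0" by (rule Lim_null_comparison[rotated])
    then have "y \<longlonglongrightarrow> x" by (rule LIM_zero_cancel)
    then show ?thesis by (rule closed_sequentially[OF closed_span_finite[OF F(1)] y(1)])
  qed
  then have "?V = UNIV" by blast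
  then show False using assms F(1) unfolding finite_dimensional_def by blast
qed

text \<open>The operator \<open>p(T)\<close>, evaluated by Horner's scheme so that induction over polynomials applies directly.\<close>
definition op_poly :: "('a::complex_normed_vector \<Rightarrow> 'a) \<Rightarrow> complex poly \<Rightarrow> 'a \<Rightarrow> 'a" where
  "op_poly T p = fold_coeffs (\<lambda>a f x. a *\<^sub>C x + T (f x)) p (\<lambda>_. 0)"

context
  fixes T :: "'a::complex_normed_vector \<Rightarrow> 'a"
  assumes T: "continuous_operator T"
begin

lemma op_poly_0: "op_poly T 0 x = 0"
  by (simp add: op_poly_def)

lemma op_poly_pCons: "op_poly T (pCons a p) x = a *\<^sub>C x + T (op_poly T p x)"
proof (cases "a = 0 \<and> p = 0")
  case True
  then show ?thesis by (simp add: op_poly_def continuous_operator_zero[OF T])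
next
  case False
  then show ?thesis by (auto simp: op_poly_def)
qed

lemma op_poly_add: "op_poly T (p + p') x = op_poly T p x + op_poly T p' x"
proof (induction p p' rule: poly_induct2)
  case (pCons a p b p')
  then show ?case
    by (simp add: op_poly_pCons continuous_operator_add[OF T] scaleC_add_left ac_simps)
qed (simp add: op_poly_0)

lemma op_poly_smult: "op_poly T (smult k p) x = k *\<^sub>C op_poly T p x"
  by (induction p)
    (simp_all add: op_poly_0 op_poly_pCons continuous_operator_scale[OF T] scaleC_add_right scaleC_scaleC)

lemma op_poly_linear_factor: "op_poly T ([:- z, 1:] * p) x = T (op_poly T p x) - z *\<^sub>C op_poly T p x"
proof -
  have "[:- z, 1:] * p = pCons 0 p + smult (- z) p" by simp
  then show ?thesis by (simp only: op_poly_add op_poly_pCons op_poly_smult) simp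
qed

lemma bounded_op_poly: "bounded (op_poly T p ` cball 0 1)"
proof (induction p)
  case 0
  then show ?case by (auto simp: op_poly_0 bounded_iff)
next
  case (pCons a p)
  obtain C where C: "\<And>x. norm (T x) \<le> C * norm x" using continuous_operator_bounded[OF T] by blast
  have "bounded ((\<lambda>x. T (op_poly T p x)) ` cball 0 1)"
    using bounded_lipschitz_image[OF pCons.IH, of T C] C by (simp flip: continuous_operator_diff[OF T])
  moreover have "bounded ((\<lambda>x. a *\<^sub>C x) ` cball 0 1 :: 'a set)"
    unfolding bounded_iff by (auto simp: norm_scaleC intro!: exI[of _ "cmod a"] mult_left_le)
  ultimately have "bounded ((\<lambda>x. a *\<^sub>C x + T (op_poly T p x)) ` cball 0 1)"
    by (rule bounded_plus_comp[rotated])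
  moreover have "op_poly T (pCons a p) = (\<lambda>x. a *\<^sub>C x + T (op_poly T p x))"
    by (rule ext) (rule op_poly_pCons)
  ultimately show ?case by metis
qed

text \<open>\<open>poly_seminorm.approximate_eigenvalue\<close> for the measure of noncompactness of \<open>p(T)\<close> on the unit ball.\<close>
theorem ex_essential_approximate_eigenvalue:
  assumes inf: "\<not> finite_dimensional (UNIV :: 'a set)"
  obtains z where "\<And>e. 0 < e \<Longrightarrow> \<exists>p.
    noncompactness (cball 0 1) (\<lambda>x. T (op_poly T p x) - z *\<^sub>C op_poly T p x)
      < e * noncompactness (cball 0 1) (op_poly T p)"
proof -
  interpret q: poly_seminorm "\<lambda>p. noncompactness (cball 0 1) (op_poly T p)"
  proof
    show "noncompactness (cball 0 1) (op_poly T (p + p'))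
        \<le> noncompactness (cball 0 1) (op_poly T p) + noncompactness (cball 0 1) (op_poly T p')" for p p'
      using noncompactness_add[OF bounded_op_poly bounded_op_poly, of p p'] by (simp flip: op_poly_add)
    show "noncompactness (cball 0 1) (op_poly T (smult k p))
        = cmod k * noncompactness (cball 0 1) (op_poly T p)" for k p
      using noncompactness_scaleC[OF bounded_op_poly, of k p] by (simp flip: op_poly_smult)
  qed
  obtain C where C: "0 \<le> C" "\<And>x. norm (T x) \<le> C * norm x" using continuous_operator_bounded[OF T] by blast
  have "noncompactness (cball 0 1) (op_poly T ([:0, 1:] * p))
      \<le> C * noncompactness (cball 0 1) (op_poly T p)" for p
  proof -
    have "op_poly T ([:0, 1:] * p) = (\<lambda>x. T (op_poly T p x))"
      by (rule ext) (simp add: op_poly_pCons)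
    then show ?thesis
      using noncompactness_lipschitz[OF bounded_op_poly C(1), of T p] C(2)
      by (simp flip: continuous_operator_diff[OF T])
  qed
  moreover have "noncompactness (cball 0 1) (op_poly T 1) \<noteq> 0"
  proof -
    have "op_poly T 1 = (\<lambda>x. x)"
      by (rule ext) (simp add: one_pCons op_poly_pCons op_poly_0 continuous_operator_zero[OF T])
    then show ?thesis using noncompactness_unit_ball_pos[OF inf] by simp
  qed
  ultimately obtain z where "\<And>e. 0 < e \<Longrightarrow> \<exists>p. noncompactness (cball 0 1) (op_poly T ([:- z, 1:] * p))
      < e * noncompactness (cball 0 1) (op_poly T p)"
    using q.approximate_eigenvalue[OF C(1)] by metis
  then show ?thesis using that[of z] unfolding op_poly_linear_factor by blast
qed

end

section \<open>Biorthogonal sequences of almost kernel vectors\<close>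

text \<open>Subtracting \<open>P \<circ> f\<close>, which has relatively compact range, changes the measure of noncompactness
  neither of \<open>f\<close> nor of \<open>L \<circ> f\<close>, so \<open>f\<close> may be replaced by \<open>(I - P) \<circ> f\<close>. Points with almost the same image under \<open>L\<close> then fall into finitely many
  classes, and some class contains two points that are far apart, since otherwise one
  representative of each class would give too fine a net. Their difference, normalised, is the vector sought.\<close>
lemma ex_approximate_kernel_vector:
  fixes L :: "'a::complex_banach \<Rightarrow> 'a"
  assumes L: "continuous_operator L" and P: "compact_operator P"
    and f: "bounded (f ` D)" and e: "0 < e"
    and small: "noncompactness D (\<lambda>a. L (f a)) < e / 4 * noncompactness D f"
  obtains w where "norm (w - P w) = 1" "norm (L (w - P w)) \<le> e"
proof -
  have Pc: "continuous_operator P" using P by (simp add: compact_operator_def)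
  define g where "g = (\<lambda>a. f a - P (f a))"
  have bP: "bounded ((\<lambda>a. P (f a)) ` D)" by (rule bounded_continuous_operator_image[OF Pc f])
  have g: "bounded (g ` D)" unfolding g_def by (intro bounded_minus_comp f bP)
  have nP: "noncompactness D (\<lambda>a. P (f a)) = 0" by (rule noncompactness_compact_operator[OF P f])
  have f_le: "noncompactness D f \<le> noncompactness D g"
    using noncompactness_add[OF g bP] nP by (simp add: g_def)
  have Lg_le: "noncompactness D (\<lambda>a. L (g a)) \<le> noncompactness D (\<lambda>a. L (f a))"
  proof -
    obtain C where C: "0 \<le> C" "\<And>x y. norm (- L x - - L y) \<le> C * norm (x - y)"
      using continuous_operator_lipschitz[OF L] by (metis minus_diff_minus norm_minus_cancel)
    have "noncompactness D (\<lambda>a. - L (P (f a))) \<le> 0"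
      using noncompactness_lipschitz[OF bP C] nP by simp
    moreover have "bounded ((\<lambda>a. - L (P (f a))) ` D)"
      by (rule bounded_lipschitz_image[OF bP C(2)])
    ultimately show ?thesis
      using noncompactness_add[OF bounded_continuous_operator_image[OF L f], of "\<lambda>a. - L (P (f a))"]
      by (simp add: g_def continuous_operator_diff[OF L])
  qed
  define \<rho> where "\<rho> = noncompactness D g"
  have "0 \<le> noncompactness D (\<lambda>a. L (f a))"
    by (rule noncompactness_nonneg[OF bounded_continuous_operator_image[OF L f]])
  then have \<rho>: "0 < \<rho>" using small e f_le unfolding \<rho>_def
    by (smt (verit) divide_pos_pos zero_less_mult_pos)
  have "e / 4 * noncompactness D f \<le> e / 4 * \<rho>" using e f_le unfolding \<rho>_def by (intro mult_left_mono) auto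
  then have "noncompactness D (\<lambda>a. L (g a)) < e / 4 * \<rho>" using Lg_le small by linarith
  then have "finite_net D (\<lambda>a. L (g a)) (e / 4 * \<rho>)"
    by (intro finite_net_noncompactness bounded_continuous_operator_image[OF L g])
  then obtain G where G: "finite G" "\<And>a. a \<in> D \<Longrightarrow> \<exists>u\<in>G. norm (L (g a) - u) \<le> e / 4 * \<rho>"
    unfolding finite_net_def by blast
  have "\<exists>a\<in>D. \<exists>b\<in>D. \<exists>u. norm (L (g a) - u) \<le> e / 4 * \<rho> \<and> norm (L (g b) - u) \<le> e / 4 * \<rho>
      \<and> \<rho> / 2 < norm (g a - g b)"
  proof (rule ccontr)
    assume neg: "\<not> ?thesis"
    \<comment> \<open>A representative of the class of points whose image is close to \<open>u\<close>.\<close>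
    define r where "r = (\<lambda>u. SOME b. b \<in> D \<and> norm (L (g b) - u) \<le> e / 4 * \<rho>)"
    have "finite_net D g (\<rho> / 2)"
      unfolding finite_net_def
    proof (intro exI[of _ "(\<lambda>u. g (r u)) ` G"] conjI ballI)
      fix a assume a: "a \<in> D"
      then obtain u where u: "u \<in> G" "norm (L (g a) - u) \<le> e / 4 * \<rho>" using G(2) by blast
      have "r u \<in> D \<and> norm (L (g (r u)) - u) \<le> e / 4 * \<rho>"
        unfolding r_def by (rule someI[of _ a]) (use a u in simp)
      then have "norm (g a - g (r u)) \<le> \<rho> / 2" using neg a u by (meson not_le)
      then show "\<exists>v\<in>(\<lambda>u. g (r u)) ` G. norm (g a - v) \<le> \<rho> / 2" using u by blast
    qed (use G(1) in simp)
    then have "\<rho> \<le> \<rho> / 2" unfolding \<rho>_def[symmetric]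
      using noncompactness_le[of "\<rho> / 2" D g] \<rho> by (simp add: \<rho>_def)
    then show False using \<rho> by simp
  qed
  then obtain a b u where ab: "norm (L (g a) - u) \<le> e / 4 * \<rho>" "norm (L (g b) - u) \<le> e / 4 * \<rho>"
      "\<rho> / 2 < norm (g a - g b)" by blast
  define y where "y = g a - g b"
  define c where "c = complex_of_real (1 / norm y)"
  have y: "\<rho> / 2 < norm y" "0 < norm y" using ab(3) \<rho> unfolding y_def by linarith+
  have "norm (L y) \<le> norm (L (g a) - u) + norm (L (g b) - u)"
    using norm_triangle_ineq4[of "L (g a) - u" "L (g b) - u"]
    by (simp add: y_def continuous_operator_diff[OF L])
  then have "norm (L y) \<le> e * (\<rho> / 2)" using ab by simp
  also have "\<dots> \<le> e * norm y" using y e by (intro mult_left_mono) auto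
  finally have Ly: "norm (L y) \<le> e * norm y" .
  define w where "w = c *\<^sub>C (f a - f b)"
  have w: "w - P w = c *\<^sub>C y"
    by (simp add: w_def y_def g_def continuous_operator_scale[OF Pc] continuous_operator_diff[OF Pc]
        complex_vector.scale_right_diff_distrib)
  have cy: "cmod c = 1 / norm y" by (simp add: c_def norm_divide)
  show ?thesis
  proof (rule that)
    show "norm (w - P w) = 1" using y by (simp add: w norm_scaleC cy)
    show "norm (L (w - P w)) \<le> e"
      using y Ly by (simp add: w continuous_operator_scale[OF L] norm_scaleC cy field_simps)
  qed
qed

text \<open>Let \<open>P\<close> be the projection onto the span of the vectors chosen so far. Each new vector \<open>z\<close> is taken in
  the range of \<open>I - P\<close>, where the earlier functionals vanish; the new functional is \<open>\<phi> \<circ> (I - P)\<close>, with \<open>\<phi>\<close>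
  norming \<open>z\<close>, and vanishes at the earlier vectors. Its norm is bounded by that of \<open>I - P\<close>,
  which is known before \<open>z\<close> is chosen, so \<open>L z\<close> can be made small enough to compensate for it.\<close>
lemma ex_biorthogonal_sequence:
  fixes L :: "'a::complex_banach \<Rightarrow> 'a"
  assumes approx: "\<And>P e. compact_operator P \<Longrightarrow> 0 < e \<Longrightarrow>
      \<exists>w. norm (w - P w) = 1 \<and> norm (L (w - P w)) \<le> e"
  obtains y :: "nat \<Rightarrow> 'a" and \<psi> where "\<And>n. continuous_functional (\<psi> n)"
    "\<And>i j. \<psi> i (y j) = (if i = j then 1 else 0)"
    "\<And>n x. cmod (\<psi> n x) * norm (L (y n)) \<le> (1 / 2) ^ n * norm x"
proof -
  define R where "R = (\<lambda>(h :: nat \<Rightarrow> 'a \<times> ('a \<Rightarrow> complex)) n (r :: 'a \<times> ('a \<Rightarrow> complex)).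
    continuous_functional (snd r) \<and> snd r (fst r) = 1 \<and>
    (\<forall>j<n. snd (h j) (fst r) = 0 \<and> snd r (fst (h j)) = 0) \<and>
    (\<forall>x. cmod (snd r x) * norm (L (fst r)) \<le> (1 / 2) ^ n * norm x))"
  have "\<exists>h. \<forall>n. R h n (h n)"
  proof (rule dependent_wellorder_choice)
    show "R h n r = R h' n r" if "\<And>m. m < n \<Longrightarrow> h m = h' m" for r h h' n
      using that by (auto simp: R_def)
  next
    fix n h assume IH: "\<And>m. m < n \<Longrightarrow> R h m (h m)"
    define y where "y = (\<lambda>j. fst (h j))"
    define \<psi> where "\<psi> = (\<lambda>j. snd (h j))"
    have fn: "continuous_functional (\<psi> j)" if "j < n" for j
      using IH[OF that] by (simp add: R_def \<psi>_def)
    have biorth: "\<psi> i (y j) = (if i = j then 1 else 0)" if "i < n" "j < n" for i j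
      using IH[OF that(1)] IH[OF that(2)]
      by (cases i j rule: linorder_cases) (auto simp: R_def \<psi>_def y_def)
    define P where "P = (\<lambda>x. \<Sum>j<n. \<psi> j x *\<^sub>C y j)"
    have P: "compact_operator P"
      unfolding P_def by (intro compact_operator_sum compact_operator_rank_one fn)
    then have Pc: "continuous_operator P" by (simp add: compact_operator_def)
    have Py: "P (y i) = y i" if "i < n" for i
    proof -
      have "P (y i) = (\<Sum>j<n. if j = i then y i else 0)"
        unfolding P_def using that by (intro sum.cong) (auto simp: biorth)
      then show ?thesis using that by simp
    qed
    have \<psi>P: "\<psi> i (P x) = \<psi> i x" if "i < n" for i x
    proof -
      have "\<psi> i (P x) = (\<Sum>j<n. if j = i then \<psi> i x else 0)"
        unfolding P_def functional_sum[OF fn[OF that]] using that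
        by (intro sum.cong) (auto simp: biorth functional_scale[OF fn[OF that]])
      then show ?thesis using that by simp
    qed
    have Q: "continuous_operator (\<lambda>x. x - P x)"
      using continuous_operator_plus[OF continuous_operator_id continuous_operator_scaled[OF Pc, of "-1"]]
      by simp
    obtain M where M: "0 \<le> M" "\<And>x. norm (x - P x) \<le> M * norm x"
      using continuous_operator_bounded[OF Q] by blast
    obtain w where w: "norm (w - P w) = 1" "norm (L (w - P w)) \<le> (1 / 2) ^ n / (M + 1)"
      using approx[OF P, of "(1 / 2) ^ n / (M + 1)"] M(1) by auto
    define z where "z = w - P w"
    have \<psi>z: "\<psi> j z = 0" if "j < n" for j
      using that by (simp add: z_def functional_diff[OF fn] \<psi>P)
    then have Pz: "P z = 0" by (simp add: P_def)
    obtain \<phi> where \<phi>: "Vector_Spaces.linear scaleC (*) \<phi>" "\<And>x. cmod (\<phi> x) \<le> norm x" "\<phi> z = norm z"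
      using ex_norming_functional[of z] by blast
    define \<eta> where "\<eta> = (\<lambda>x. \<phi> (x - P x))"
    have \<eta>_le: "cmod (\<eta> x) \<le> M * norm x" for x
      unfolding \<eta>_def using \<phi>(2) M(2) order.trans by blast
    have \<phi>c: "continuous_functional \<phi>"
      unfolding continuous_functional_def using \<phi>(1,2) by (intro conjI exI[of _ 1]) auto
    have "Vector_Spaces.linear scaleC (*) \<eta>"
    proof (rule complex_functionalI)
      show "\<eta> (x + x') = \<eta> x + \<eta> x'" for x x'
        using functional_add[OF \<phi>c, of "x - P x" "x' - P x'"]
        by (simp add: \<eta>_def continuous_operator_add[OF Pc] algebra_simps)
      show "\<eta> (c *\<^sub>C x) = c * \<eta> x" for c x
        using functional_scale[OF \<phi>c, of c "x - P x"]
        by (simp add: \<eta>_def continuous_operator_scale[OF Pc] complex_vector.scale_right_diff_distrib)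
    qed
    then have \<eta>: "continuous_functional \<eta>" unfolding continuous_functional_def using \<eta>_le by blast
    have "R h n (z, \<eta>)"
      unfolding R_def fst_conv snd_conv
    proof (intro conjI allI impI \<eta>)
      show "\<eta> z = 1" using \<phi>(3) w(1) by (simp add: \<eta>_def Pz) (simp add: z_def)
      fix x
      have "cmod (\<eta> x) * norm (L z) \<le> (M * norm x) * ((1 / 2) ^ n / (M + 1))"
        using \<eta>_le[of x] w(2) M(1) unfolding z_def by (intro mult_mono) auto
      also have "\<dots> = (M / (M + 1)) * ((1 / 2) ^ n * norm x)" by simp
      also have "\<dots> \<le> 1 * ((1 / 2) ^ n * norm x)" using M(1) by (intro mult_right_mono) auto
      finally show "cmod (\<eta> x) * norm (L z) \<le> (1 / 2) ^ n * norm x" by simp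
    next
      fix j assume j: "j < n"
      show "snd (h j) z = 0" using \<psi>z[OF j] by (simp add: \<psi>_def)
      show "\<eta> (fst (h j)) = 0"
        using Py[OF j] functional_zero[OF \<phi>c] by (simp add: \<eta>_def y_def)
    qed
    then show "\<exists>r. R h n r" by blast
  qed
  then obtain h where h: "\<And>n. R h n (h n)" by blast
  show ?thesis
  proof (rule that[of "\<lambda>n. snd (h n)" "\<lambda>n. fst (h n)"])
    show "snd (h i) (fst (h j)) = (if i = j then 1 else 0)" for i j
      using h[of i] h[of j] by (cases i j rule: linorder_cases) (auto simp: R_def)
  qed (use h in \<open>auto simp: R_def\<close>)
qed

text \<open>Used twice: for the infinite dimension and for the infinite codimension of the halfspace.\<close>
lemma no_biorthogonal_sequence_in_finite_span:
  fixes w :: "nat \<Rightarrow> 'a::complex_normed_vector"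
  assumes B: "finite B" "\<And>n. w n \<in> complex_vector.span B"
    and \<eta>: "\<And>n. continuous_functional (\<eta> n)"
    and biorth: "\<And>i j. \<eta> i (w j) = (if i = j then 1 else 0)"
  shows False
proof -
  have inj: "inj w" using biorth by (metis injI zero_neq_one)
  have "w n \<notin> complex_vector.span (range w - {w n})" for n
  proof
    assume "w n \<in> complex_vector.span (range w - {w n})"
    also have "\<dots> \<subseteq> {x. \<eta> n x = 0}"
      using biorth by (intro complex_vector.span_minimal subspace_kernel \<eta>) auto
    finally show False using biorth[of n n] by simp
  qed
  then have "complex_vector.independent (range w)"
    unfolding complex_vector.dependent_def by blast
  moreover have "range w \<subseteq> complex_vector.span B" using B(2) by blast
  ultimately have "finite (range w)"
    using complex_vector.independent_span_bound[OF B(1)] by blast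
  then show False using inj finite_imageD infinite_UNIV_nat by blast
qed

section \<open>Essentially invariant halfspaces\<close>

theorem corollary4p3:
  fixes T :: "'a::complex_banach \<Rightarrow> 'a"
  assumes "\<not> finite_dimensional (UNIV :: 'a set)"
    and "continuous_operator T"
  shows "\<exists>Y. halfspace Y \<and> essentially_invariant T Y"
proof -
  obtain z where z: "\<And>e. 0 < e \<Longrightarrow> \<exists>p.
      noncompactness (cball 0 1) (\<lambda>x. T (op_poly T p x) - z *\<^sub>C op_poly T p x)
        < e * noncompactness (cball 0 1) (op_poly T p)"
    using ex_essential_approximate_eigenvalue[OF assms(2,1)] by blast
  define L where "L = (\<lambda>x. T x - z *\<^sub>C x)"
  have L: "continuous_operator L"
    using continuous_operator_plus[OF assms(2) continuous_operator_scaled[OF continuous_operator_id, of "- z"]]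
    by (simp add: L_def)
  have approx: "\<exists>w. norm (w - P w) = 1 \<and> norm (L (w - P w)) \<le> e" if P: "compact_operator P" and e: "0 < e" for P e
  proof -
    obtain p where p: "noncompactness (cball 0 1) (\<lambda>x. L (op_poly T p x))
        < e / 4 * noncompactness (cball 0 1) (op_poly T p)"
      using z[of "e / 4"] e by (auto simp: L_def)
    show ?thesis
      using ex_approximate_kernel_vector[OF L P bounded_op_poly[OF assms(2)] e p] by blast
  qed
  obtain y :: "nat \<Rightarrow> 'a" and \<psi> where \<psi>: "\<And>n. continuous_functional (\<psi> n)"
    and biorth: "\<And>i j. \<psi> i (y j) = (if i = j then 1 else 0)"
    and bound: "\<And>n x. cmod (\<psi> n x) * norm (L (y n)) \<le> (1 / 2) ^ n * norm x"
  proof (rule ex_biorthogonal_sequence)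
    show "\<exists>w. norm (w - P w) = 1 \<and> norm (L (w - P w)) \<le> e"
      if "compact_operator P" "0 < e" for P e
      using that by (rule approx)
  qed (rule that)
  define K where "K = (\<lambda>x. \<Sum>n. \<psi> n x *\<^sub>C - L (y n))"
  have K: "compact_operator K"
    unfolding K_def
  proof (rule compact_operator_suminf[where b = "\<lambda>n. (1 / 2) ^ n"])
    show "compact_operator (\<lambda>x. \<psi> n x *\<^sub>C - L (y n))" for n
      by (rule compact_operator_rank_one[OF \<psi>])
    show "norm (\<psi> n x *\<^sub>C - L (y n)) \<le> (1 / 2) ^ n * norm x" for n x
      using bound by (simp add: norm_scaleC)
  qed simp
  then have Kc: "continuous_operator K" by (simp add: compact_operator_def)
  have Ky: "K (y m) = - L (y m)" for m
  proof -
    have "K (y m) = (\<Sum>n\<in>{m}. \<psi> n (y m) *\<^sub>C - L (y n))"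
      unfolding K_def by (rule suminf_finite) (auto simp: biorth)
    then show ?thesis by (simp add: biorth)
  qed
  \<comment> \<open>The space where \<open>T + K\<close> acts as the scalar \<open>z\<close>.\<close>
  define E where "E = {x. L x + K x = 0}"
  have LK: "continuous_operator (\<lambda>x. L x + K x)" by (rule continuous_operator_plus[OF L Kc])
  have E: "complex_vector.subspace E" "closed E"
  proof -
    show "complex_vector.subspace E"
      unfolding E_def complex_vector.subspace_def
      using continuous_operator_zero[OF LK] continuous_operator_add[OF LK] continuous_operator_scale[OF LK]
      by simp
    show "closed E"
      unfolding E_def using LK
      by (intro closed_Collect_eq continuous_on_const) (simp add: continuous_operator_def)
  qed
  define Y where "Y = closure (complex_vector.span (range (\<lambda>n. y (2 * n))))"
  have Y_sub: "Y \<subseteq> F" if "complex_vector.subspace F" "closed F" "\<And>n. y (2 * n) \<in> F" for F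
    unfolding Y_def using that by (intro closure_minimal complex_vector.span_minimal) auto
  have Y: "complex_vector.subspace Y" "closed Y"
    unfolding Y_def by (simp_all add: closed_subspace_closure complex_vector.subspace_span)
  have yY: "y (2 * n) \<in> Y" for n
    unfolding Y_def by (meson closure_subset complex_vector.span_base rangeI subsetD)
  \<comment> \<open>Functionals with odd index separate the cosets of the \<open>y n\<close> with odd \<open>n\<close>.\<close>
  have odd: "\<psi> (2 * k + 1) x = 0" if "x \<in> Y" for k x
  proof -
    have "2 * k + 1 \<noteq> 2 * n" for n by presburger
    then have "Y \<subseteq> {x. \<psi> (2 * k + 1) x = 0}"
      by (intro Y_sub subspace_kernel closed_kernel \<psi>) (simp add: biorth)
    then show ?thesis using that by blast
  qed
  have "\<not> finite_dimensional Y"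
  proof
    assume "finite_dimensional Y"
    then obtain B where "finite B" "complex_vector.span B = Y" unfolding finite_dimensional_def by blast
    then show False
      using no_biorthogonal_sequence_in_finite_span[of B "\<lambda>n. y (2 * n)" "\<lambda>n. \<psi> (2 * n)"] yY \<psi>
      by (simp add: biorth)
  qed
  moreover have "\<not> finite_codimensional Y"
  proof
    assume "finite_codimensional Y"
    then obtain B where B: "finite B" "\<And>x. \<exists>b\<in>complex_vector.span B. x - b \<in> Y"
      unfolding finite_codimensional_def by blast
    have "\<forall>n. \<exists>b. b \<in> complex_vector.span B \<and> y (2 * n + 1) - b \<in> Y" using B(2) by blast
    then obtain b where b: "\<And>n. b n \<in> complex_vector.span B" "\<And>n. y (2 * n + 1) - b n \<in> Y"
      by metis
    have "\<psi> (2 * i + 1) (b j) = (if i = j then 1 else 0)" for i j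
      using odd[OF b(2), of i j] unfolding functional_diff[OF \<psi>] biorth by simp
    then show False
      using no_biorthogonal_sequence_in_finite_span[of B b "\<lambda>n. \<psi> (2 * n + 1)"] B(1) b(1) \<psi> by simp
  qed
  ultimately have "halfspace Y" using Y by (simp add: halfspace_def)
  moreover have "essentially_invariant T Y"
    unfolding essentially_invariant_def
  proof (intro exI[of _ K] conjI K image_subsetI)
    fix x assume x: "x \<in> Y"
    have "Y \<subseteq> E" using E by (intro Y_sub) (simp_all add: E_def Ky)
    then have "T x + K x = z *\<^sub>C x" using x by (auto simp: E_def L_def algebra_simps)
    then show "T x + K x \<in> Y" using complex_vector.subspace_scale[OF Y(1) x] by simp
  qed
  ultimately show ?thesis by blast
qed

end
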